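(* Let $F,c,\gamma,(b_m)_{m\in\mathbb Z},w$ satisfy the general assumptions (see context), and let $\gamma^2>4F'(-c)$. Then there exists a neighborhood $D\subset\mathbb R$ of $0$ such that for all $\epsilon\in D$ there exists a sequence $v(\epsilon)\in\mathcal L_{\sigma_0,w}$, with $\sigma_0>0$ as defined in the context, such that $$x_n(t):=cn+\epsilon b_0-v(\epsilon)(0,0)+\sum_{m\in\mathbb Z}v(\epsilon)(n,m)e^{im\gamma t},\qquad n\ge1,$$ is a time periodic, real valued solution of the differential equation $$\ddot x_n(t)=F(x_{n-1}(t)-x_n(t))-F(x_n(t)-x_{n+1}(t)),\quad n\ge1,\qquad x_0(t):=\epsilon\sum_{m\in\mathbb Z}b_me^{i\gamma mt}.$$
   Context: General assumptions: $c\in\mathbb R$; $F:\mathbb R\to\mathbb R$ is real analytic in a neighborhood of $-c$ with $F'(-c)>0$; $\gamma>0$ with $\frac{(m\gamma)^2}{F'(-c)}\ne4$ for all $m\in\mathbb Z$; $w:\mathbb Z\to\mathbb R$ is an admissible weight function, i.e. $w(m)\ge1$ and $w(m)\le w(m-n)w(n)$ for all $m,n\in\mathbb Z$; $(b_m)_{m\in\mathbb Z}$ is a complex sequence with $\sum_mw(m)|b_m|=1$ and $b_{-m}=\overline{b_m}$. For $\sigma\in\mathbb R$, $\mathcal L_{\sigma,w}$ is the Banach space of $u:\mathbb N_0\times\mathbb Z\to\mathbb C$ with $\|u\|_{\sigma,w}:=\sum_{m\in\mathbb Z}w(m)\sup_{n\ge0}e^{\sigma n}|u(n,m)|<\infty$.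 $\delta_m:=-2+\frac{(m\gamma)^2}{F'(-c)}$; $m_0:=\max\{m\in\mathbb Z:0\le\frac{(m\gamma)^2}{F'(-c)}\le4\}$ (here $m_0=0$); for $|m|>m_0$, $z_m:=-\frac{\delta_m}2+\sqrt{\frac{\delta_m^2}4-1}$; $\sigma_0:=\min(1,-\frac12\ln|z_{m_0+1}|)$. *)

theory Defs
  imports "HOL-Analysis.Analysis"
begin

text \<open>Real analyticity in a neighbourhood of a point: the function has a convergent
  Taylor expansion around every point of some open set containing \<open>a\<close>.\<close>

definition real_analytic_near :: "(real \<Rightarrow> real) \<Rightarrow> real \<Rightarrow> bool" where
  "real_analytic_near F a \<longleftrightarrow>
     (\<exists>U. open U \<and> a \<in> U \<and> (\<forall>y\<in>U. \<exists>P. (\<lambda>h. F (y + h)) has_fps_expansion P))"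

definition admissible_weight :: "(int \<Rightarrow> real) \<Rightarrow> bool" where
  "admissible_weight w \<longleftrightarrow> (\<forall>m. 1 \<le> w m) \<and> (\<forall>m n. w m \<le> w (m - n) * w n)"

text \<open>The norm is taken in the extended nonnegative reals, where suprema and sums always
  exist; finiteness then also forces every single supremum to be finite.\<close>

definition weighted_norm :: "real \<Rightarrow> (int \<Rightarrow> real) \<Rightarrow> (nat \<Rightarrow> int \<Rightarrow> complex) \<Rightarrow> ennreal" where
  "weighted_norm \<sigma> w u =
     (\<Sum>\<^sub>\<infinity>m. ennreal (w m) * (SUP n. ennreal (exp (\<sigma> * real n) * cmod (u n m))))"

definition weighted_space :: "real \<Rightarrow> (int \<Rightarrow> real) \<Rightarrow> (nat \<Rightarrow> int \<Rightarrow> complex) set" where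
  "weighted_space \<sigma> w = {u. weighted_norm \<sigma> w u < \<infinity>}"

text \<open>In the following four definitions the parameter \<open>a\<close> stands for \<open>F'(-c)\<close>.\<close>

definition delta :: "real \<Rightarrow> real \<Rightarrow> int \<Rightarrow> real" where
  "delta a \<gamma> m = - 2 + (of_int m * \<gamma>)\<^sup>2 / a"

text \<open>For \<open>a > 0\<close> and \<open>\<gamma> > 0\<close> the set is finite and contains \<open>0\<close>.\<close>

definition m_zero :: "real \<Rightarrow> real \<Rightarrow> int" where
  "m_zero a \<gamma> = Max {m. 0 \<le> (of_int m * \<gamma>)\<^sup>2 / a \<and> (of_int m * \<gamma>)\<^sup>2 / a \<le> 4}"

text \<open>Only meaningful for \<open>\<bar>m\<bar> > m_zero a \<gamma>\<close>, where the radicand is positive.\<close>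

definition z_root :: "real \<Rightarrow> real \<Rightarrow> int \<Rightarrow> real" where
  "z_root a \<gamma> m = - (delta a \<gamma> m / 2) + sqrt ((delta a \<gamma> m)\<^sup>2 / 4 - 1)"

definition sigma_zero :: "real \<Rightarrow> real \<Rightarrow> real" where
  "sigma_zero a \<gamma> = min 1 (- (1 / 2) * ln \<bar>z_root a \<gamma> (m_zero a \<gamma> + 1)\<bar>)"

definition lattice_solution :: "(real \<Rightarrow> real) \<Rightarrow> (nat \<Rightarrow> real \<Rightarrow> real) \<Rightarrow> bool" where
  "lattice_solution F x \<longleftrightarrow>
     (\<forall>n\<ge>1. \<exists>x'. \<forall>t.
        (x n has_real_derivative x' t) (at t) \<and>
        (x' has_real_derivative (F (x (n - 1) t - x n t) - F (x n t - x (n + 1) t))) (at t))"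

text \<open>The period is common to all particles.\<close>

definition time_periodic :: "(nat \<Rightarrow> real \<Rightarrow> real) \<Rightarrow> bool" where
  "time_periodic x \<longleftrightarrow> (\<exists>T>0. \<forall>n t. x n (t + T) = x n t)"

end

theory Submission
  imports Defs
begin

text \<open>
  Write \<open>x\<^sub>n(t) = c n + y\<^sub>n(t)\<close> and expand \<open>y\<^sub>n\<close> in a Fourier series in time. With \<open>a = F'(-c)\<close>
  and \<open>W\<^sub>n\<close> the coefficients of the part of the force \<open>F(-c + s)\<close>, \<open>s = y\<^sub>n - y\<^sub>n\<^sub>+\<^sub>1\<close>, that is at least
  quadratic in \<open>s\<close>, the equation of motion in the mode \<open>m\<close> is a second order difference equation in
  \<open>n\<close>:
    \<open>y(n+2,m) + \<delta>\<^sub>m y(n+1,m) + y(n,m) = - (W(n,m) - W(n+1,m)) / a\<close>.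
  For \<open>m = 0\<close> it can be summed once: \<open>a (y(n,0) - y(n+1,0)) + W(n,0)\<close> does not depend on \<open>n\<close>, and for a
  decaying strain it has to vanish.

  The assumption \<open>\<gamma>\<^sup>2 > 4a\<close> says that every mode \<open>m \<noteq> 0\<close> lies above the band of frequencies that the
  linear chain transmits, that is \<open>\<delta>\<^sub>m > 2\<close>. Then the linear part can be inverted by iteration: the difference equation
  is solved for \<open>y(n+1,m)\<close>, and the summed equation of the mode \<open>0\<close> for \<open>y(n,0)\<close>. In the norm weighted
  with \<open>e\<^bsup>\<sigma>n\<^esup>\<close> the two neighbours enter with the factor \<open>(e\<^sup>\<sigma> + e\<^bsup>-\<sigma>\<^esup>) / \<delta>\<^sub>m\<close>, and the shift in the mode
  \<open>0\<close> with the factor \<open>e\<^bsup>-\<sigma>\<^esup>\<close>. Since \<open>\<delta>\<^sub>1 = \<bar>z\<^sub>1\<bar> + 1/\<bar>z\<^sub>1\<bar>\<close> and \<open>e\<^bsup>2\<sigma>\<^esup> \<le> 1/\<bar>z\<^sub>1\<bar>\<close> at \<open>\<sigma> = \<sigma>\<^sub>0\<close>, both factors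
  are below \<open>1\<close>, uniformly in \<open>m\<close> (\<open>sigma_zero_bounds\<close>, \<open>step_lipschitz\<close>).

  The weight \<open>w\<close> is submultiplicative, so the weighted space is an algebra under convolution in
  \<open>m\<close> (\<open>nrm_conv\<close>), and an analytic function without linear part is Lipschitz there with an arbitrarily
  small constant on a small ball (\<open>nrm_pseries_diff\<close>, \<open>small_lipschitz_constant\<close>). The whole right
  hand side is therefore a contraction of a small ball if the driver is small, and its fixed point is
  the required sequence \<open>v\<close>, which differs from \<open>y\<close> by a constant in the mode \<open>0\<close>
  (\<open>small_fixed_points\<close>). The iteration preserves the symmetry
  \<open>u(n,-m) = cnj (u(n,m))\<close>, which makes the solution real.

  Finally, the equation itself bounds \<open>(m\<gamma>)\<^sup>2 v(n,m)\<close>, \<open>n \<ge> 1\<close>, by summable coefficients. So the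
  series may be differentiated twice term by term, and the evaluation of Fourier series, a homomorphism
  of algebras (\<open>trig_conv\<close>), turns the equation for the coefficients back into the lattice equation
  (\<open>fixed_point_solves_lattice\<close>).
\<close>

section \<open>Unconditional sums in the extended nonnegative reals\<close>

text \<open>Integrals over the counting measure give sums in \<open>[0,\<infinity>]\<close> for which addition, scaling and
  Tonelli's theorem hold without side conditions. Summability of complex families is then read off
  from the finiteness of such a sum.\<close>

abbreviation esum :: "('a \<Rightarrow> ennreal) \<Rightarrow> ennreal"
  where "esum f \<equiv> (\<integral>\<^sup>+x. f x \<partial>count_space UNIV)"

lemma abs_summable_if_esum_finite:
  fixes f :: "'a \<Rightarrow> complex"
  assumes "esum (\<lambda>x. ennreal (norm (f x))) < \<infinity>"
  shows "(\<lambda>x. norm (f x)) summable_on UNIV"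
proof -
  have "integrable (count_space UNIV) f"
    using assms by (intro integrableI_bounded) auto
  then show ?thesis
    by (simp add: abs_summable_equivalent Infinite_Set_Sum.abs_summable_on_def)
qed

lemma esum_eq_infsum:
  fixes f :: "'a \<Rightarrow> real"
  assumes "f summable_on UNIV" and "\<And>x. 0 \<le> f x"
  shows "esum (\<lambda>x. ennreal (f x)) = ennreal (infsum f UNIV)"
proof -
  have "Infinite_Set_Sum.abs_summable_on f UNIV"
    using assms by (subst abs_summable_equivalent[symmetric]) simp
  then show ?thesis
    using assms(2) nn_integral_conv_infsetsum[of f UNIV] infsetsum_infsum[of f UNIV] by simp
qed

lemma infsum_le_esum:
  fixes f :: "'a \<Rightarrow> ennreal"
  shows "infsum f UNIV \<le> esum f"
proof -
  have "sum f A \<le> esum f" if "finite A" for A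
  proof -
    have "sum f A = (\<integral>\<^sup>+x. f x * indicator A x \<partial>count_space UNIV)"
      using that by (subst nn_integral_indicator_finite) auto
    also have "\<dots> \<le> esum f"
      by (intro nn_integral_mono) (auto simp: indicator_def)
    finally show ?thesis .
  qed
  then show ?thesis
    by (subst nonneg_infsum_complete) (auto intro: SUP_least)
qed

lemma norm_infsum_le_esum:
  fixes f :: "'a \<Rightarrow> complex"
  shows "ennreal (norm (infsum f UNIV)) \<le> esum (\<lambda>x. ennreal (norm (f x)))"
proof (cases "esum (\<lambda>x. ennreal (norm (f x))) < \<infinity>")
  case True
  note * = abs_summable_if_esum_finite[OF True]
  have "norm (infsum f UNIV) \<le> (\<Sum>\<^sub>\<infinity>x. norm (f x))"
    by (rule norm_infsum_bound[OF *])
  then show ?thesis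
    using esum_eq_infsum[OF *] by (simp add: ennreal_leI)
qed (auto simp: not_less top_unique)

lemma le_esum: "f x \<le> esum f"
proof -
  have "f x = (\<integral>\<^sup>+y. f y * indicator {x} y \<partial>count_space UNIV)"
    by (subst nn_integral_indicator_finite) auto
  also have "\<dots> \<le> esum f"
    by (intro nn_integral_mono) (auto simp: indicator_def)
  finally show ?thesis .
qed

lemma esum_swap:
  fixes f :: "'a :: countable \<Rightarrow> 'b \<Rightarrow> ennreal"
  shows "esum (\<lambda>x. esum (f x)) = esum (\<lambda>y. esum (\<lambda>x. f x y))"
  by (rule nn_integral_count_space_nn_integral[symmetric]) auto

lemma esum_shift:
  fixes f :: "int \<Rightarrow> ennreal"
  shows "esum (\<lambda>m. f (m - k)) = esum f"
  by (rule nn_integral_bij_count_space) (rule bij_betwI[of _ _ _ "\<lambda>m. m + k"]; simp)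

text \<open>The Fubini hypothesis for every interchange of complex sums below.\<close>

lemma abs_summable_pairs:
  fixes f :: "'a \<Rightarrow> 'b \<Rightarrow> complex"
  assumes "esum (\<lambda>x. esum (\<lambda>y. ennreal (norm (f x y)))) < \<infinity>"
  shows "(\<lambda>(x, y). f x y) summable_on UNIV \<times> UNIV"
proof -
  have "(\<lambda>p. norm (f (fst p) (snd p))) summable_on UNIV"
    using assms by (intro abs_summable_if_esum_finite)
      (simp add: nn_integral_fst_count_space[symmetric])
  then show ?thesis
    using abs_summable_summable by (fastforce simp: case_prod_unfold)
qed

section \<open>The convolution algebra of summable Fourier coefficients\<close>

definition conv :: "(int \<Rightarrow> complex) \<Rightarrow> (int \<Rightarrow> complex) \<Rightarrow> int \<Rightarrow> complex"
  where "conv f g m = (\<Sum>\<^sub>\<infinity>k. f k * g (m - k))"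

abbreviation l1norm :: "(int \<Rightarrow> complex) \<Rightarrow> ennreal"
  where "l1norm f \<equiv> esum (\<lambda>m. ennreal (cmod (f m)))"

text \<open>The Fourier series with coefficients \<open>f\<close>, at the phase \<open>\<theta> = \<gamma>t\<close>.\<close>

definition trig :: "(int \<Rightarrow> complex) \<Rightarrow> real \<Rightarrow> complex"
  where "trig f \<theta> = (\<Sum>\<^sub>\<infinity>m. f m * cis (of_int m * \<theta>))"

lemma esum_conv_terms:
  "esum (\<lambda>k. esum (\<lambda>m. ennreal (cmod (f k * g (m - k))))) = l1norm f * l1norm g"
proof -
  have "esum (\<lambda>m. ennreal (cmod (f k * g (m - k)))) = ennreal (cmod (f k)) * l1norm g" for k
    by (simp add: norm_mult ennreal_mult nn_integral_cmult esum_shift[of "\<lambda>m. ennreal (cmod (g m))"])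
  then show ?thesis
    by (simp add: nn_integral_multc)
qed

lemma conv_terms_summable:
  assumes "l1norm f < \<infinity>" and "l1norm g < \<infinity>"
  shows "(\<lambda>k. f k * g (m - k)) summable_on UNIV"
proof -
  have "esum (\<lambda>k. ennreal (cmod (f k * g (m - k)))) \<le> l1norm f * l1norm g"
    unfolding esum_conv_terms[symmetric]
    by (intro nn_integral_mono le_esum[where x = m and f = "\<lambda>m. ennreal (cmod (f _ * g (m - _)))"])
  also have "\<dots> < \<infinity>"
    using assms by (simp add: ennreal_mult_less_top)
  finally show ?thesis
    by (rule abs_summable_summable[OF abs_summable_if_esum_finite])
qed

lemma l1norm_conv: "l1norm (conv f g) \<le> l1norm f * l1norm g"
proof -
  have "l1norm (conv f g) \<le> esum (\<lambda>m. esum (\<lambda>k. ennreal (cmod (f k * g (m - k)))))"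
    unfolding conv_def by (intro nn_integral_mono norm_infsum_le_esum)
  also have "\<dots> = l1norm f * l1norm g"
    by (subst esum_swap) (rule esum_conv_terms)
  finally show ?thesis .
qed

lemma trig_summable:
  assumes "l1norm f < \<infinity>"
  shows "(\<lambda>m. f m * cis (of_int m * \<theta>)) summable_on UNIV"
  using assms by (intro abs_summable_summable[OF abs_summable_if_esum_finite]) (simp add: norm_mult)

lemma cmod_trig_le: "ennreal (cmod (trig f \<theta>)) \<le> l1norm f"
  unfolding trig_def using norm_infsum_le_esum[of "\<lambda>m. f m * cis (of_int m * \<theta>)"]
  by (simp add: norm_mult)

text \<open>Collecting the terms of the double series \<open>f(k) g(l) e\<^bsup>i(k+l)\<theta>\<^esup>\<close> by \<open>m = k + l\<close> gives the
  convolution; absolute convergence of the double series allows this.\<close>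

lemma trig_conv:
  assumes "l1norm f < \<infinity>" and "l1norm g < \<infinity>"
  shows "trig (conv f g) \<theta> = trig f \<theta> * trig g \<theta>"
proof -
  let ?e = "\<lambda>m. cis (of_int m * \<theta>)"
  have "trig f \<theta> * trig g \<theta> = (\<Sum>\<^sub>\<infinity>k. f k * ?e k * trig g \<theta>)"
    unfolding trig_def[of f] by (rule infsum_cmult_left'[symmetric])
  also have "\<dots> = (\<Sum>\<^sub>\<infinity>k. \<Sum>\<^sub>\<infinity>m. f k * g (m - k) * ?e m)"
  proof (rule infsum_cong)
    fix k
    have "trig g \<theta> = (\<Sum>\<^sub>\<infinity>m. g (m - k) * ?e (m - k))"
      unfolding trig_def
      by (rule infsum_reindex_bij_betw[symmetric])
        (rule bij_betwI[of _ _ _ "\<lambda>m. m + k"]; simp)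
    then have "f k * ?e k * trig g \<theta> = (\<Sum>\<^sub>\<infinity>m. f k * ?e k * (g (m - k) * ?e (m - k)))"
      by (simp add: infsum_cmult_right')
    also have "\<dots> = (\<Sum>\<^sub>\<infinity>m. f k * g (m - k) * ?e m)"
    proof (rule infsum_cong)
      fix m
      have "?e k * ?e (m - k) = ?e m"
        by (simp add: cis_mult algebra_simps)
      then show "f k * ?e k * (g (m - k) * ?e (m - k)) = f k * g (m - k) * ?e m"
        by (metis (no_types, lifting) mult.assoc mult.left_commute)
    qed
    finally show "f k * ?e k * trig g \<theta> = (\<Sum>\<^sub>\<infinity>m. f k * g (m - k) * ?e m)" .
  qed
  also have "\<dots> = (\<Sum>\<^sub>\<infinity>m. \<Sum>\<^sub>\<infinity>k. f k * g (m - k) * ?e m)"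
  proof (rule infsum_swap_banach, rule abs_summable_pairs)
    have "esum (\<lambda>k. esum (\<lambda>m. ennreal (cmod (f k * g (m - k) * ?e m)))) = l1norm f * l1norm g"
      unfolding esum_conv_terms[symmetric] by (simp add: norm_mult)
    also have "\<dots> < \<infinity>"
      using assms by (simp add: ennreal_mult_less_top)
    finally show "esum (\<lambda>k. esum (\<lambda>m. ennreal (cmod (f k * g (m - k) * ?e m)))) < \<infinity>" .
  qed
  also have "\<dots> = trig (conv f g) \<theta>"
    by (simp add: trig_def conv_def infsum_cmult_left')
  finally show ?thesis by simp
qed

text \<open>The coefficient sequences of real valued functions.\<close>

definition hermitian :: "(int \<Rightarrow> complex) \<Rightarrow> bool"
  where "hermitian f \<longleftrightarrow> (\<forall>m. f (- m) = cnj (f m))"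

lemma infsum_uminus_int:
  fixes f :: "int \<Rightarrow> complex"
  shows "(\<Sum>\<^sub>\<infinity>m. f (- m)) = (\<Sum>\<^sub>\<infinity>m. f m)"
  by (rule infsum_reindex_bij_betw) (rule bij_betwI[of _ _ _ uminus]; simp)

lemma hermitian_conv:
  assumes "hermitian f" and "hermitian g"
  shows "hermitian (conv f g)"
  unfolding hermitian_def
proof
  fix m
  have "conv f g (- m) = (\<Sum>\<^sub>\<infinity>k. f (- k) * g (- m - - k))"
    unfolding conv_def by (rule infsum_uminus_int[symmetric])
  also have "\<dots> = (\<Sum>\<^sub>\<infinity>k. cnj (f k * g (m - k)))"
    using assms unfolding hermitian_def
    by (intro infsum_cong) (metis complex_cnj_mult minus_diff_minus)
  also have "\<dots> = cnj (conv f g m)"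
    unfolding conv_def by (rule infsum_cnj)
  finally show "conv f g (- m) = cnj (conv f g m)" .
qed

lemma trig_real:
  assumes "hermitian f"
  shows "trig f \<theta> \<in> \<real>"
proof -
  have "cnj (trig f \<theta>) = (\<Sum>\<^sub>\<infinity>m. f (- m) * cis (of_int (- m) * \<theta>))"
    using assms by (simp add: trig_def hermitian_def cis_cnj flip: infsum_cnj)
  also have "\<dots> = trig f \<theta>"
    unfolding trig_def by (rule infsum_uminus_int)
  finally show ?thesis
    by (simp add: complex_is_Real_iff complex_cnj_cancel_iff complex_eq_iff)
qed

lemma infsum_minus_distrib:
  fixes f g :: "'a \<Rightarrow> complex"
  assumes "f summable_on A" and "g summable_on A"
  shows "(\<Sum>\<^sub>\<infinity>x\<in>A. f x - g x) = infsum f A - infsum g A"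
  using infsum_add[OF assms(1), of "\<lambda>x. - g x"] assms(2)
  by (simp add: infsum_uminus summable_on_uminus)

text \<open>The telescoping form of bilinearity, from which the Lipschitz bounds of powers follow by induction.\<close>

lemma conv_diff:
  assumes "l1norm f < \<infinity>" "l1norm f' < \<infinity>" "l1norm g < \<infinity>" "l1norm g' < \<infinity>"
  shows "conv f g m - conv f' g' m = conv f (\<lambda>k. g k - g' k) m + conv (\<lambda>k. f k - f' k) g' m"
proof -
  note s = conv_terms_summable[of _ _ m]
  have "conv f (\<lambda>k. g k - g' k) m = conv f g m - conv f g' m"
    unfolding conv_def by (subst infsum_minus_distrib[symmetric])
      (use s assms in \<open>simp_all add: right_diff_distrib\<close>)
  moreover have "conv (\<lambda>k. f k - f' k) g' m = conv f g' m - conv f' g' m"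
    unfolding conv_def by (subst infsum_minus_distrib[symmetric])
      (use s assms in \<open>simp_all add: left_diff_distrib\<close>)
  ultimately show ?thesis by simp
qed

lemma l1norm_add: "l1norm (\<lambda>m. f m + g m) \<le> l1norm f + l1norm g"
proof -
  have "l1norm (\<lambda>m. f m + g m) \<le> esum (\<lambda>m. ennreal (cmod (f m)) + ennreal (cmod (g m)))"
    by (intro nn_integral_mono) (simp add: norm_triangle_ineq flip: ennreal_plus)
  then show ?thesis
    by (simp add: nn_integral_add)
qed

lemma l1norm_scale: "l1norm (\<lambda>m. c * f m) = ennreal (cmod c) * l1norm f"
  by (subst nn_integral_cmult[symmetric]) (simp_all add: norm_mult ennreal_mult)

lemma l1_scale: "l1norm f < \<infinity> \<Longrightarrow> l1norm (\<lambda>m. c * f m) < \<infinity>"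
  by (simp add: l1norm_scale ennreal_mult_less_top)

lemma l1_add: "l1norm f < \<infinity> \<Longrightarrow> l1norm g < \<infinity> \<Longrightarrow> l1norm (\<lambda>m. f m + g m) < \<infinity>"
  by (rule le_less_trans[OF l1norm_add]) simp

lemma l1_diff: "l1norm f < \<infinity> \<Longrightarrow> l1norm g < \<infinity> \<Longrightarrow> l1norm (\<lambda>m. f m - g m) < \<infinity>"
  using l1_add[of f "\<lambda>m. - 1 * g m"] l1_scale[of g "- 1"] by simp

lemma trig_scale: "trig (\<lambda>m. c * f m) \<theta> = c * trig f \<theta>"
  by (simp add: trig_def mult.assoc infsum_cmult_right')

lemma trig_add:
  "l1norm f < \<infinity> \<Longrightarrow> l1norm g < \<infinity> \<Longrightarrow> trig (\<lambda>m. f m + g m) \<theta> = trig f \<theta> + trig g \<theta>"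
  unfolding trig_def by (simp add: distrib_right infsum_add trig_summable)

lemma trig_diff:
  "l1norm f < \<infinity> \<Longrightarrow> l1norm g < \<infinity> \<Longrightarrow> trig (\<lambda>m. f m - g m) \<theta> = trig f \<theta> - trig g \<theta>"
  using trig_add[of f "\<lambda>m. - 1 * g m"] l1_scale[of g "- 1"] trig_scale[of "- 1" g] by simp

section \<open>Power series in the convolution algebra\<close>

text \<open>\<open>cpow f j\<close> is the power with exponent \<open>j + 1\<close>. The power with exponent \<open>0\<close>, the unit of the algebra, is
  avoided because as a sequence constant in \<open>n\<close> it has infinite norm in the space of decaying
  sequences.\<close>

primrec cpow :: "(int \<Rightarrow> complex) \<Rightarrow> nat \<Rightarrow> int \<Rightarrow> complex"
  where "cpow f 0 = f"
  | "cpow f (Suc j) = conv f (cpow f j)"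

lemma l1norm_cpow: "l1norm (cpow f j) \<le> l1norm f ^ Suc j"
proof (induction j)
  case (Suc j)
  then show ?case
    using order_trans[OF l1norm_conv mult_left_mono] by simp
qed simp

lemma l1norm_cpow_finite: "l1norm f < \<infinity> \<Longrightarrow> l1norm (cpow f j) < \<infinity>"
  using le_less_trans[OF l1norm_cpow] by (simp add: power_less_top_ennreal ennreal_mult_less_top)

lemma trig_cpow:
  assumes "l1norm f < \<infinity>"
  shows "trig (cpow f j) \<theta> = trig f \<theta> ^ Suc j"
  using trig_conv[OF assms l1norm_cpow_finite[OF assms]] by (induction j) simp_all

lemma hermitian_cpow: "hermitian f \<Longrightarrow> hermitian (cpow f j)"
  by (induction j) (simp_all add: hermitian_conv)

text \<open>The series \<open>\<Sum>\<^sub>j h\<^sub>j f\<^bsup>j+2\<^esup>\<close>, which begins with the quadratic term.\<close>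

definition pseries :: "(nat \<Rightarrow> real) \<Rightarrow> (int \<Rightarrow> complex) \<Rightarrow> int \<Rightarrow> complex"
  where "pseries h f m = (\<Sum>\<^sub>\<infinity>j. of_real (h j) * cpow f (Suc j) m)"

lemma trig_pseries:
  assumes "l1norm f \<le> ennreal s" and "0 \<le> s" and "summable (\<lambda>j. \<bar>h j\<bar> * s ^ (j + 2))"
  shows "trig (pseries h f) \<theta> = (\<Sum>\<^sub>\<infinity>j. of_real (h j) * trig f \<theta> ^ (j + 2))"
    and "l1norm (pseries h f) < \<infinity>"
proof -
  have fin: "l1norm f < \<infinity>"
    using assms(1) le_less_trans by fastforce
  have fin2: "esum (\<lambda>j. esum (\<lambda>m. ennreal (cmod (of_real (h j) * cpow f (Suc j) m)))) < \<infinity>"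
  proof -
    have "esum (\<lambda>m. ennreal (cmod (of_real (h j) * cpow f (Suc j) m))) \<le> ennreal (\<bar>h j\<bar> * s ^ (j + 2))" for j
    proof -
      have "esum (\<lambda>m. ennreal (cmod (of_real (h j) * cpow f (Suc j) m)))
          = ennreal \<bar>h j\<bar> * l1norm (cpow f (Suc j))"
        by (simp add: norm_mult ennreal_mult nn_integral_cmult del: cpow.simps)
      also have "\<dots> \<le> ennreal \<bar>h j\<bar> * ennreal s ^ (j + 2)"
        using order_trans[OF l1norm_cpow power_mono[OF assms(1)], of "Suc j"]
        by (intro mult_left_mono) (simp_all del: cpow.simps)
      finally show ?thesis
        using assms(2) by (simp add: ennreal_mult ennreal_power)
    qed
    then have "esum (\<lambda>j. esum (\<lambda>m. ennreal (cmod (of_real (h j) * cpow f (Suc j) m))))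
        \<le> (\<Sum>j. ennreal (\<bar>h j\<bar> * s ^ (j + 2)))"
      unfolding nn_integral_count_space_nat[symmetric] by (intro nn_integral_mono) simp
    also have "\<dots> < \<infinity>"
      using assms by (subst suminf_ennreal2) auto
    finally show ?thesis .
  qed
  have "l1norm (pseries h f) \<le> esum (\<lambda>m. esum (\<lambda>j. ennreal (cmod (of_real (h j) * cpow f (Suc j) m))))"
    unfolding pseries_def by (intro nn_integral_mono norm_infsum_le_esum)
  also have "\<dots> < \<infinity>"
    using fin2 by (subst esum_swap)
  finally show "l1norm (pseries h f) < \<infinity>" .
  have "trig (pseries h f) \<theta>
      = (\<Sum>\<^sub>\<infinity>m. \<Sum>\<^sub>\<infinity>j. of_real (h j) * cpow f (Suc j) m * cis (of_int m * \<theta>))"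
    by (simp add: trig_def pseries_def infsum_cmult_left' del: cpow.simps)
  also have "\<dots> = (\<Sum>\<^sub>\<infinity>j. \<Sum>\<^sub>\<infinity>m. of_real (h j) * cpow f (Suc j) m * cis (of_int m * \<theta>))"
    using fin2 by (intro infsum_swap_banach[symmetric] abs_summable_pairs)
      (simp add: norm_mult del: cpow.simps)
  also have "\<dots> = (\<Sum>\<^sub>\<infinity>j. of_real (h j) * trig (cpow f (Suc j)) \<theta>)"
    by (simp add: trig_def infsum_cmult_right' mult.assoc del: cpow.simps)
  finally show "trig (pseries h f) \<theta> = (\<Sum>\<^sub>\<infinity>j. of_real (h j) * trig f \<theta> ^ (j + 2))"
    by (simp add: trig_cpow[OF fin] del: cpow.simps)
qed

lemma hermitian_pseries:
  assumes "hermitian f"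
  shows "hermitian (pseries h f)"
  using hermitian_cpow[OF assms]
  by (simp add: hermitian_def pseries_def flip: infsum_cnj del: cpow.simps)

section \<open>Termwise differentiation of Fourier series\<close>

lemma infsum_int_sums:
  fixes f :: "int \<Rightarrow> complex"
  assumes "(\<lambda>m. norm (f m)) summable_on UNIV"
  shows "(\<lambda>n. f (int_decode n)) sums infsum f UNIV"
proof -
  have "(f has_sum infsum f UNIV) UNIV"
    using assms abs_summable_summable by (auto intro: has_sum_infsum)
  then have "((\<lambda>n. f (int_decode n)) has_sum infsum f UNIV) UNIV"
    using has_sum_reindex_bij_betw[OF bij_int_decode, of f] by simp
  then show ?thesis
    by (rule has_sum_imp_sums)
qed

lemma trig_sums:
  assumes "l1norm f < \<infinity>"
  shows "(\<lambda>n. f (int_decode n) * cis (of_int (int_decode n) * \<theta>)) sums trig f \<theta>"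
  unfolding trig_def using assms
  by (intro infsum_int_sums abs_summable_if_esum_finite) (simp add: norm_mult)

text \<open>The derivatives of the terms have the summable majorant \<open>\<bar>\<gamma> m f(m)\<bar>\<close>, so their series
  converges uniformly. The integers are enumerated to apply the theorem for sequences of functions.\<close>

lemma Re_trig_has_derivative:
  assumes f: "l1norm f < \<infinity>" and f': "l1norm (\<lambda>m. of_int m * f m) < \<infinity>"
  shows "((\<lambda>t. Re (trig f (\<gamma> * t))) has_real_derivative
    Re (trig (\<lambda>m. \<i> * of_real \<gamma> * (of_int m * f m)) (\<gamma> * t))) (at t)"
proof -
  define e where "e = int_decode"
  let ?f' = "\<lambda>m. \<i> * of_real \<gamma> * (of_int m * f m)"
  let ?g = "\<lambda>n t. Re (f (e n) * cis (of_int (e n) * (\<gamma> * t)))"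
  let ?g' = "\<lambda>n t. Re (?f' (e n) * cis (of_int (e n) * (\<gamma> * t)))"
  have "l1norm ?f' = ennreal \<bar>\<gamma>\<bar> * l1norm (\<lambda>m. of_int m * f m)"
    by (subst nn_integral_cmult[symmetric]) (simp_all add: norm_mult ennreal_mult mult.assoc)
  then have l1f': "l1norm ?f' < \<infinity>"
    using f' by (simp add: ennreal_mult_less_top)
  have g: "(\<lambda>n. ?g n t) sums Re (trig f (\<gamma> * t))" for t
    unfolding e_def by (intro sums_Re trig_sums f)
  have g': "(\<lambda>n. ?g' n t) sums Re (trig ?f' (\<gamma> * t))" for t
    unfolding e_def by (intro sums_Re trig_sums l1f')
  have "summable (\<lambda>n. cmod (?f' (e n)))"
  proof -
    have "(\<lambda>m. cmod (?f' m)) summable_on UNIV"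
      by (rule abs_summable_if_esum_finite[OF l1f'])
    then have "(\<lambda>n. cmod (?f' (e n))) summable_on UNIV"
      unfolding e_def using summable_on_reindex_bij_betw[OF bij_int_decode, of "\<lambda>m. cmod (?f' m)"]
      by simp
    then show ?thesis
      by (rule summable_on_UNIV_nonneg_real_iff[THEN iffD1, rotated]) simp
  qed
  moreover have bound: "norm (?g' n t) \<le> cmod (?f' (e n))" for n t
    using abs_Re_le_cmod[of "?f' (e n) * cis (of_int (e n) * (\<gamma> * t))"]
    by (simp only: norm_mult norm_cis mult_1_right real_norm_def)
  ultimately have unif: "uniformly_convergent_on UNIV (\<lambda>n t. \<Sum>i<n. ?g' i t)"
    by (intro Weierstrass_m_test'[where M = "\<lambda>n. cmod (?f' (e n))"])
      (use bound in blast)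
  have "((\<lambda>t. \<Sum>n. ?g n t) has_field_derivative (\<Sum>n. ?g' n t)) (at t)"
  proof (rule has_field_derivative_series'(2)[OF convex_UNIV _ unif])
    show "(?g n has_field_derivative ?g' n t) (at t within UNIV)" for n t
      by (auto intro!: derivative_eq_intros simp: algebra_simps)
  qed (use g in \<open>auto simp: sums_iff\<close>)
  then show ?thesis
    using g g' by (simp add: sums_iff)
qed

section \<open>The weighted norm on space-time coefficients\<close>

locale weighted =
  fixes \<sigma> :: real and w :: "int \<Rightarrow> real"
  assumes sigma_nonneg: "0 \<le> \<sigma>" and weight: "admissible_weight w"
begin

text \<open>The spatial part of the norm, separately in every mode \<open>m\<close>.\<close>

definition env :: "(nat \<Rightarrow> int \<Rightarrow> complex) \<Rightarrow> int \<Rightarrow> ennreal"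
  where "env u m = (SUP n. ennreal (exp (\<sigma> * real n) * cmod (u n m)))"

definition nrm :: "(nat \<Rightarrow> int \<Rightarrow> complex) \<Rightarrow> ennreal"
  where "nrm u = esum (\<lambda>m. ennreal (w m) * env u m)"

lemma weight_ge_1: "1 \<le> w m"
  using weight by (simp add: admissible_weight_def)

lemma weight_split: "ennreal (w m) \<le> ennreal (w k) * ennreal (w (m - k))"
proof -
  have "w m \<le> w k * w (m - k)"
    using weight by (simp add: admissible_weight_def mult.commute)
  moreover have "0 \<le> w k"
    using weight_ge_1[of k] by simp
  ultimately show ?thesis
    by (simp add: ennreal_mult' flip: ennreal_mult') (metis ennreal_leI ennreal_mult')
qed

lemma weighted_norm_le_nrm: "weighted_norm \<sigma> w u \<le> nrm u"
  unfolding weighted_norm_def nrm_def env_def by (rule infsum_le_esum)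

lemma env_upper: "ennreal (exp (\<sigma> * real n) * cmod (u n m)) \<le> env u m"
  unfolding env_def by (rule SUP_upper) simp

lemma cmod_le_env: "ennreal (cmod (u n m)) \<le> env u m"
proof -
  have "1 * cmod (u n m) \<le> exp (\<sigma> * real n) * cmod (u n m)"
    using sigma_nonneg by (intro mult_right_mono) auto
  then show ?thesis
    using env_upper[of n u m] by (metis ennreal_leI mult_1 order_trans)
qed

lemma env_le_weighted: "env u m \<le> ennreal (w m) * env u m"
  using mult_right_mono[of 1 "ennreal (w m)" "env u m"] weight_ge_1[of m] by simp

lemma env_le_nrm: "env u m \<le> nrm u"
  unfolding nrm_def by (rule order_trans[OF env_le_weighted le_esum[where x = m]])

lemma cmod_le_nrm: "ennreal (cmod (u n m)) \<le> nrm u"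
  using cmod_le_env env_le_nrm order_trans by blast

lemma l1norm_le_nrm: "l1norm (u n) \<le> nrm u"
  unfolding nrm_def by (intro nn_integral_mono order_trans[OF cmod_le_env env_le_weighted])

lemma nrm_le:
  assumes "\<And>n m. ennreal (exp (\<sigma> * real n) * cmod (u n m)) \<le> A m"
  shows "nrm u \<le> esum (\<lambda>m. ennreal (w m) * A m)"
  unfolding nrm_def env_def by (intro nn_integral_mono mult_left_mono SUP_least assms) simp

text \<open>All linear estimates are proved in this way: a bound in every single mode, with
  constants independent of the mode, passes to the norm.\<close>

lemma nrm_le_lincomb:
  assumes "\<And>n m. ennreal (exp (\<sigma> * real n) * cmod (u n m)) \<le> p * env v m + q * env v' m"
  shows "nrm u \<le> p * nrm v + q * nrm v'"
proof -
  have "nrm u \<le> esum (\<lambda>m. ennreal (w m) * (p * env v m + q * env v' m))"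
    by (rule nrm_le) (rule assms)
  also have "\<dots> = esum (\<lambda>m. p * (ennreal (w m) * env v m) + q * (ennreal (w m) * env v' m))"
    by (simp add: distrib_left mult.left_commute)
  also have "\<dots> = p * nrm v + q * nrm v'"
    unfolding nrm_def by (subst nn_integral_add) (auto simp: nn_integral_cmult)
  finally show ?thesis .
qed

lemma nrm_add: "nrm (\<lambda>n m. u n m + v n m) \<le> nrm u + nrm v"
proof -
  have "ennreal (exp (\<sigma> * real n) * cmod (u n m + v n m)) \<le> 1 * env u m + 1 * env v m" for n m
  proof -
    have "ennreal (exp (\<sigma> * real n) * cmod (u n m + v n m))
      \<le> ennreal (exp (\<sigma> * real n) * cmod (u n m) + exp (\<sigma> * real n) * cmod (v n m))"
      by (intro ennreal_leI) (simp add: norm_triangle_ineq flip: distrib_left)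
    also have "\<dots> \<le> env u m + env v m"
      by (simp add: add_mono env_upper)
    finally show ?thesis by simp
  qed
  from nrm_le_lincomb[OF this] show ?thesis by simp
qed

lemma nrm_infsum: "nrm (\<lambda>n m. \<Sum>\<^sub>\<infinity>j::nat. U j n m) \<le> esum (\<lambda>j. nrm (U j))"
proof -
  have "nrm (\<lambda>n m. \<Sum>\<^sub>\<infinity>j. U j n m) \<le> esum (\<lambda>m. ennreal (w m) * esum (\<lambda>j. env (U j) m))"
  proof (rule nrm_le)
    fix n m
    have "ennreal (exp (\<sigma> * real n) * cmod (\<Sum>\<^sub>\<infinity>j. U j n m))
      = ennreal (exp (\<sigma> * real n)) * ennreal (cmod (\<Sum>\<^sub>\<infinity>j. U j n m))"
      by (simp add: ennreal_mult)
    also have "\<dots> \<le> ennreal (exp (\<sigma> * real n)) * esum (\<lambda>j. ennreal (cmod (U j n m)))"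
      by (intro mult_left_mono norm_infsum_le_esum) simp
    also have "\<dots> = esum (\<lambda>j. ennreal (exp (\<sigma> * real n) * cmod (U j n m)))"
      by (simp add: ennreal_mult nn_integral_cmult)
    also have "\<dots> \<le> esum (\<lambda>j. env (U j) m)"
      by (intro nn_integral_mono env_upper)
    finally show "ennreal (exp (\<sigma> * real n) * cmod (\<Sum>\<^sub>\<infinity>j. U j n m)) \<le> esum (\<lambda>j. env (U j) m)" .
  qed
  also have "\<dots> = esum (\<lambda>m. esum (\<lambda>j. ennreal (w m) * env (U j) m))"
    by (simp add: nn_integral_cmult)
  also have "\<dots> = esum (\<lambda>j. nrm (U j))"
    unfolding nrm_def by (rule esum_swap)
  finally show ?thesis .
qed

lemma nrm_scale: "nrm (\<lambda>n m. c * u n m) \<le> ennreal (cmod c) * nrm u"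
proof -
  have "ennreal (exp (\<sigma> * real n) * cmod (c * u n m)) \<le> ennreal (cmod c) * env u m + 0 * env u m" for n m
  proof -
    have "ennreal (exp (\<sigma> * real n) * cmod (c * u n m))
      = ennreal (cmod c) * ennreal (exp (\<sigma> * real n) * cmod (u n m))"
      by (simp add: norm_mult mult.left_commute flip: ennreal_mult)
    also have "\<dots> \<le> ennreal (cmod c) * env u m"
      by (intro mult_left_mono env_upper) simp
    finally show ?thesis by simp
  qed
  from nrm_le_lincomb[OF this] show ?thesis by simp
qed

lemma nrm_eq_0_imp: "nrm u = 0 \<Longrightarrow> u n m = 0"
  using cmod_le_nrm[of u n m] by simp

text \<open>Young's inequality for \<open>\<ell>\<^sup>1\<close>: the weight \<open>w(m)\<close> is distributed over the two factors by
  \<open>w(m) \<le> w(k) w(m - k)\<close>. In \<open>n\<close> the product is pointwise, and as \<open>\<sigma> \<ge> 0\<close> the exponential weight on one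
  factor is enough.\<close>

lemma nrm_conv: "nrm (\<lambda>n. conv (u n) (v n)) \<le> nrm u * nrm v"
proof -
  have "nrm (\<lambda>n. conv (u n) (v n)) \<le> esum (\<lambda>m. ennreal (w m) * esum (\<lambda>k. env u k * env v (m - k)))"
  proof (rule nrm_le)
    fix n m
    let ?e = "exp (\<sigma> * real n)"
    have "ennreal (?e * cmod (conv (u n) (v n) m)) = ennreal ?e * ennreal (cmod (conv (u n) (v n) m))"
      by (simp add: ennreal_mult)
    also have "\<dots> \<le> ennreal ?e * esum (\<lambda>k. ennreal (cmod (u n k * v n (m - k))))"
      unfolding conv_def by (intro mult_left_mono norm_infsum_le_esum) simp
    also have "\<dots> = esum (\<lambda>k. ennreal (?e * cmod (u n k)) * ennreal (cmod (v n (m - k))))"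
      by (simp add: nn_integral_cmult[symmetric] norm_mult ennreal_mult mult.assoc)
    also have "\<dots> \<le> esum (\<lambda>k. env u k * env v (m - k))"
      by (intro nn_integral_mono mult_mono env_upper cmod_le_env) auto
    finally show "ennreal (?e * cmod (conv (u n) (v n) m)) \<le> esum (\<lambda>k. env u k * env v (m - k))" .
  qed
  also have "\<dots> = esum (\<lambda>m. esum (\<lambda>k. ennreal (w m) * (env u k * env v (m - k))))"
    by (simp add: nn_integral_cmult)
  also have "\<dots> \<le> esum (\<lambda>m. esum (\<lambda>k. (ennreal (w k) * env u k) * (ennreal (w (m - k)) * env v (m - k))))"
  proof (intro nn_integral_mono)
    fix m k
    have "ennreal (w m) * (env u k * env v (m - k))
      \<le> (ennreal (w k) * ennreal (w (m - k))) * (env u k * env v (m - k))"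
      by (intro mult_right_mono weight_split) simp
    then show "ennreal (w m) * (env u k * env v (m - k))
      \<le> (ennreal (w k) * env u k) * (ennreal (w (m - k)) * env v (m - k))"
      by (simp add: mult_ac)
  qed
  also have "\<dots> = esum (\<lambda>k. esum (\<lambda>m. (ennreal (w k) * env u k) * (ennreal (w (m - k)) * env v (m - k))))"
    by (rule esum_swap)
  also have "\<dots> = esum (\<lambda>k. ennreal (w k) * env u k * nrm v)"
    unfolding nrm_def
    by (simp add: nn_integral_cmult esum_shift[of "\<lambda>m. ennreal (w m) * env v m"])
  also have "\<dots> = nrm u * nrm v"
    unfolding nrm_def[of u] by (simp add: nn_integral_multc)
  finally show ?thesis .
qed

lemma nrm_cpow: "nrm (\<lambda>n. cpow (u n) j) \<le> nrm u ^ Suc j"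
proof (induction j)
  case (Suc j)
  then show ?case
    using order_trans[OF nrm_conv mult_left_mono[OF Suc], of u] by simp
qed simp

text \<open>The analogue of \<open>\<bar>x\<^bsup>j+1\<^esup> - y\<^bsup>j+1\<^esup>\<bar> \<le> (j+1) s\<^sup>j \<bar>x - y\<bar>\<close> for \<open>\<bar>x\<bar>, \<bar>y\<bar> \<le> s\<close>.\<close>

lemma nrm_cpow_diff:
  assumes u: "nrm u \<le> ennreal s" and v: "nrm v \<le> ennreal s" and s: "0 \<le> s"
  shows "nrm (\<lambda>n m. cpow (u n) j m - cpow (v n) j m)
    \<le> ennreal (real (Suc j) * s ^ j) * nrm (\<lambda>n m. u n m - v n m)"
proof (induction j)
  case (Suc j)
  let ?d = "nrm (\<lambda>n m. u n m - v n m)"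
  have fin: "l1norm (u n) < \<infinity>" "l1norm (v n) < \<infinity>" for n
    using order_trans[OF l1norm_le_nrm u, of n] order_trans[OF l1norm_le_nrm v, of n]
    by (auto intro: le_less_trans)
  have "nrm (\<lambda>n m. cpow (u n) (Suc j) m - cpow (v n) (Suc j) m)
      = nrm (\<lambda>n m. conv (u n) (\<lambda>k. cpow (u n) j k - cpow (v n) j k) m
                   + conv (\<lambda>k. u n k - v n k) (cpow (v n) j) m)"
    using conv_diff[OF fin(1) fin(2) l1norm_cpow_finite[OF fin(1)] l1norm_cpow_finite[OF fin(2)]]
    by simp
  also have "\<dots> \<le> nrm u * nrm (\<lambda>n m. cpow (u n) j m - cpow (v n) j m)
      + ?d * nrm (\<lambda>n. cpow (v n) j)"
    by (intro order_trans[OF nrm_add] add_mono nrm_conv)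
  also have "\<dots> \<le> ennreal s * (ennreal (real (Suc j) * s ^ j) * ?d) + ?d * ennreal s ^ Suc j"
    by (intro add_mono mult_mono Suc u order_trans[OF nrm_cpow power_mono] v) auto
  also have "\<dots> = ennreal (real (Suc (Suc j)) * s ^ Suc j) * ?d"
  proof -
    have "ennreal s * (ennreal (real (Suc j) * s ^ j) * ?d) + ?d * ennreal s ^ Suc j
      = (ennreal (s * (real (Suc j) * s ^ j)) + ennreal (s ^ Suc j)) * ?d"
      using s by (simp add: ennreal_mult ennreal_power distrib_left distrib_right mult_ac
          del: of_nat_Suc power_Suc)
    also have "ennreal (s * (real (Suc j) * s ^ j)) + ennreal (s ^ Suc j)
      = ennreal (s * (real (Suc j) * s ^ j) + s ^ Suc j)"
      using s by (intro ennreal_plus[symmetric]) auto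
    also have "s * (real (Suc j) * s ^ j) + s ^ Suc j = real (Suc (Suc j)) * s ^ Suc j"
      by (simp add: algebra_simps)
    finally show ?thesis .
  qed
  finally show ?case .
qed simp

text \<open>The constant \<open>L\<close> is the derivative at \<open>s\<close> of the majorant series \<open>\<Sum>\<^sub>j \<bar>h\<^sub>j\<bar> s\<^bsup>j+2\<^esup>\<close>.\<close>

lemma nrm_pseries_diff:
  assumes u: "nrm u \<le> ennreal s" and v: "nrm v \<le> ennreal s" and s: "0 \<le> s"
    and h: "(\<lambda>j. \<bar>h j\<bar> * (real (j + 2) * s ^ (j + 1))) sums L"
  shows "nrm (\<lambda>n m. pseries h (u n) m - pseries h (v n) m) \<le> ennreal L * nrm (\<lambda>n m. u n m - v n m)"
proof -
  let ?d = "nrm (\<lambda>n m. u n m - v n m)"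
  let ?t = "\<lambda>j. \<bar>h j\<bar> * (real (j + 2) * s ^ (j + 1))"
  have t0: "0 \<le> ?t j" for j
    using s by simp
  have summ: "(\<lambda>j. of_real (h j) * cpow (z n) (Suc j) m) summable_on UNIV"
    if z: "nrm z \<le> ennreal s" for z n m
  proof (rule abs_summable_summable[OF abs_summable_if_esum_finite])
    have "ennreal (cmod (of_real (h j) * cpow (z n) (Suc j) m)) \<le> ennreal s * ennreal (?t j)" for j
    proof -
      have "ennreal (cmod (of_real (h j) * cpow (z n) (Suc j) m))
          = ennreal \<bar>h j\<bar> * ennreal (cmod (cpow (z n) (Suc j) m))"
        by (simp add: norm_mult ennreal_mult del: cpow.simps)
      also have "\<dots> \<le> ennreal \<bar>h j\<bar> * ennreal s ^ (j + 2)"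
      proof (intro mult_left_mono)
        have "ennreal (cmod (cpow (z n) (Suc j) m)) \<le> nrm (\<lambda>n. cpow (z n) (Suc j))"
          by (rule cmod_le_nrm)
        also have "\<dots> \<le> ennreal s ^ Suc (Suc j)"
          by (rule order_trans[OF nrm_cpow power_mono[OF z]]) simp
        finally show "ennreal (cmod (cpow (z n) (Suc j) m)) \<le> ennreal s ^ (j + 2)" by simp
      qed simp
      also have "\<dots> = ennreal (\<bar>h j\<bar> * s ^ (j + 2))"
        using s by (simp add: ennreal_mult ennreal_power)
      also have "\<dots> \<le> ennreal (s * ?t j)"
      proof (intro ennreal_leI)
        have "\<bar>h j\<bar> * s ^ (j + 2) * 1 \<le> \<bar>h j\<bar> * s ^ (j + 2) * real (j + 2)"
          using s by (intro mult_left_mono) auto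
        then show "\<bar>h j\<bar> * s ^ (j + 2) \<le> s * ?t j"
          by (simp add: mult_ac)
      qed
      finally show ?thesis
        using s t0 by (simp add: ennreal_mult)
    qed
    then have "esum (\<lambda>j. ennreal (cmod (of_real (h j) * cpow (z n) (Suc j) m)))
        \<le> esum (\<lambda>j. ennreal s * ennreal (?t j))"
      by (intro nn_integral_mono)
    also have "\<dots> = ennreal s * ennreal L"
      by (subst nn_integral_cmult) (simp_all only: borel_measurable_count_space
          nn_integral_count_space_nat suminf_ennreal_eq[OF t0 h])
    also have "\<dots> < \<infinity>"
      by (simp add: ennreal_mult_less_top)
    finally show "esum (\<lambda>j. ennreal (cmod (of_real (h j) * cpow (z n) (Suc j) m))) < \<infinity>" .
  qed
  have "nrm (\<lambda>n m. pseries h (u n) m - pseries h (v n) m)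
      = nrm (\<lambda>n m. \<Sum>\<^sub>\<infinity>j. of_real (h j) * (cpow (u n) (Suc j) m - cpow (v n) (Suc j) m))"
    unfolding pseries_def by (simp add: infsum_minus_distrib[OF summ[OF u] summ[OF v], symmetric]
        right_diff_distrib del: cpow.simps)
  also have "\<dots> \<le> esum (\<lambda>j. nrm (\<lambda>n m. of_real (h j) * (cpow (u n) (Suc j) m - cpow (v n) (Suc j) m)))"
    by (rule nrm_infsum)
  also have "\<dots> \<le> esum (\<lambda>j. ennreal (?t j) * ?d)"
  proof (intro nn_integral_mono)
    fix j :: nat
    have "nrm (\<lambda>n m. of_real (h j) * (cpow (u n) (Suc j) m - cpow (v n) (Suc j) m))
        \<le> ennreal \<bar>h j\<bar> * nrm (\<lambda>n m. cpow (u n) (Suc j) m - cpow (v n) (Suc j) m)"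
      using nrm_scale[of "of_real (h j)"] by simp
    also have "\<dots> \<le> ennreal \<bar>h j\<bar> * (ennreal (real (Suc (Suc j)) * s ^ Suc j) * ?d)"
      by (intro mult_left_mono nrm_cpow_diff u v s) simp
    also have "\<dots> = ennreal (?t j) * ?d"
      using s by (subst mult.assoc[symmetric], subst ennreal_mult[symmetric]) auto
    finally show "nrm (\<lambda>n m. of_real (h j) * (cpow (u n) (Suc j) m - cpow (v n) (Suc j) m))
      \<le> ennreal (?t j) * ?d" .
  qed
  also have "\<dots> = ennreal L * ?d"
    by (subst nn_integral_multc) (simp_all only: borel_measurable_count_space
        nn_integral_count_space_nat suminf_ennreal_eq[OF t0 h])
  finally show ?thesis .
qed

section \<open>Fixed points of contractions in the weighted norm\<close>

text \<open>Banach's fixed point theorem. Completeness of the space enters in the following form: the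
  sequence of iterates converges in every coefficient, and countable subadditivity of the norm
  (\<open>nrm_infsum\<close>) controls the distance to this limit. The predicate \<open>P\<close> transports a property of the
  iterates that survives coefficientwise limits.\<close>

lemma contraction_fixed_point:
  fixes T :: "(nat \<Rightarrow> int \<Rightarrow> complex) \<Rightarrow> nat \<Rightarrow> int \<Rightarrow> complex"
  assumes r: "0 \<le> r" and q: "0 \<le> q" "q < 1"
    and T0: "nrm (T (\<lambda>_ _. 0)) \<le> ennreal ((1 - q) * r)"
    and lip: "\<And>u v. nrm u \<le> ennreal r \<Longrightarrow> nrm v \<le> ennreal r \<Longrightarrow>
      nrm (\<lambda>n m. T u n m - T v n m) \<le> ennreal q * nrm (\<lambda>n m. u n m - v n m)"
    and P0: "P (\<lambda>_ _. 0)"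
    and P_step: "\<And>u. P u \<Longrightarrow> P (T u)"
    and P_lim: "\<And>U u. (\<And>k. P (U k)) \<Longrightarrow> (\<And>n m. (\<lambda>k. U k n m) \<longlonglongrightarrow> u n m) \<Longrightarrow> P u"
  obtains u where "nrm u \<le> ennreal r" "P u" "T u = u"
proof -
  define U where "U k = (T ^^ k) (\<lambda>_ _. 0)" for k
  have nrm0: "nrm (\<lambda>_ _. 0) = 0"
    using nrm_le[of "\<lambda>_ _. 0" "\<lambda>_. 0"] by simp
  have U_Suc: "U (Suc k) = T (U k)" for k
    by (simp add: U_def)
  have U_r: "nrm (U k) \<le> ennreal r" for k
  proof (induction k)
    case 0
    then show ?case by (simp add: U_def nrm0)
  next
    case (Suc k)
    have "nrm (U (Suc k)) = nrm (\<lambda>n m. (T (U k) n m - T (\<lambda>_ _. 0) n m) + T (\<lambda>_ _. 0) n m)"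
      by (simp add: U_Suc)
    also have "\<dots> \<le> nrm (\<lambda>n m. T (U k) n m - T (\<lambda>_ _. 0) n m) + nrm (T (\<lambda>_ _. 0))"
      by (rule nrm_add)
    also have "\<dots> \<le> ennreal q * ennreal r + ennreal ((1 - q) * r)"
      using lip[OF Suc, of "\<lambda>_ _. 0"] mult_left_mono[OF Suc, of "ennreal q"]
      by (intro add_mono T0) (auto simp: nrm0)
    also have "\<dots> = ennreal (q * r + (1 - q) * r)"
      using q r by (subst ennreal_mult[symmetric]) auto
    finally show ?case by (simp add: algebra_simps)
  qed
  define d where "d k n m = U (Suc k) n m - U k n m" for k n m
  have d_nrm: "nrm (d k) \<le> ennreal (q ^ k * r)" for k
  proof (induction k)
    case 0
    have "d 0 = U 1"
      by (simp add: d_def fun_eq_iff) (simp add: U_def)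
    then show ?case using U_r[of 1] by simp
  next
    case (Suc k)
    have "nrm (d (Suc k)) \<le> ennreal q * nrm (d k)"
      using lip[OF U_r[of "Suc k"] U_r[of k]] unfolding d_def[abs_def] U_Suc .
    also have "\<dots> \<le> ennreal q * ennreal (q ^ k * r)"
      by (intro mult_left_mono Suc) simp
    finally show ?case
      using q r by (simp add: mult.assoc flip: ennreal_mult)
  qed
  have d_le: "cmod (d k n m) \<le> q ^ k * r" for k n m
    using order_trans[OF cmod_le_nrm d_nrm, of k n m] q r by simp
  have geom: "summable (\<lambda>j. q ^ j * r)"
    using q by (intro summable_mult2 summable_geometric) simp
  have d_summable: "summable (\<lambda>j. cmod (d (k + j) n m))" for k n m
    using q r d_le[of "k + _" n m] power_decreasing[of _ "k + _" q]
    by (intro summable_comparison_test'[OF geom, of 0])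
      (auto intro!: order_trans[OF d_le] mult_right_mono power_decreasing)
  define u where "u n m = U 0 n m + (\<Sum>j. d j n m)" for n m
  have lim: "(\<lambda>k. U k n m) \<longlonglongrightarrow> u n m" for n m
  proof -
    have "(\<lambda>k. U 0 n m + (\<Sum>j<k. d j n m)) \<longlonglongrightarrow> u n m"
      unfolding u_def using summable_norm_cancel[OF d_summable[of 0 n m]]
      by (intro tendsto_intros) (simp add: summable_LIMSEQ)
    then show ?thesis
      unfolding d_def by (subst (asm) sum_lessThan_telescope) simp
  qed
  have tail: "u n m - U k n m = (\<Sum>\<^sub>\<infinity>j. d (k + j) n m)" for k n m
  proof -
    have "(\<lambda>j. d (k + j) n m) sums (u n m - U k n m)"
      using telescope_sums[OF LIMSEQ_ignore_initial_segment[OF lim[of n m], of k]]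
      by (simp add: d_def add.commute)
    then show ?thesis
      using norm_summable_imp_has_sum[OF d_summable] infsumI by metis
  qed
  have u_U: "nrm (\<lambda>n m. u n m - U k n m) \<le> ennreal (q ^ k * r / (1 - q))" for k
  proof -
    have sums: "(\<lambda>j. q ^ (k + j) * r) sums (q ^ k * r / (1 - q))"
      using sums_mult2[OF sums_mult[OF geometric_sums[of q], of "q ^ k"], of r] q
      by (simp add: power_add)
    have "nrm (\<lambda>n m. u n m - U k n m) \<le> esum (\<lambda>j. nrm (d (k + j)))"
      unfolding tail using nrm_infsum[of "\<lambda>j. d (k + j)"] by simp
    also have "\<dots> \<le> esum (\<lambda>j. ennreal (q ^ (k + j) * r))"
      by (intro nn_integral_mono d_nrm)
    also have "\<dots> = ennreal (q ^ k * r / (1 - q))"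
      unfolding nn_integral_count_space_nat using q r by (intro suminf_ennreal_eq[OF _ sums]) simp
    finally show ?thesis .
  qed
  have tend: "(\<lambda>k. ennreal (C + q ^ k * D)) \<longlonglongrightarrow> ennreal C" for C D
  proof -
    have "(\<lambda>k. C + q ^ k * D) \<longlonglongrightarrow> C + 0 * D"
      using q by (intro tendsto_intros LIMSEQ_power_zero) simp
    then show ?thesis by (intro tendsto_ennrealI) simp
  qed
  have u_r: "nrm u \<le> ennreal r"
  proof (rule LIMSEQ_le_const[OF tend[of r "r / (1 - q)"]], intro exI allI impI)
    fix k
    have "nrm u = nrm (\<lambda>n m. (u n m - U k n m) + U k n m)"
      by simp
    also have "\<dots> \<le> ennreal (q ^ k * r / (1 - q)) + ennreal r"
      by (intro order_trans[OF nrm_add] add_mono u_U U_r)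
    also have "\<dots> = ennreal (r + q ^ k * (r / (1 - q)))"
      using q r by (simp flip: ennreal_plus add: add.commute)
    finally show "nrm u \<le> ennreal (r + q ^ k * (r / (1 - q)))" .
  qed
  \<comment> \<open>both distances in \<open>T u - T U\<^sub>k\<close> and \<open>U\<^sub>k\<^sub>+\<^sub>1 - u\<close> tend to \<open>0\<close>\<close>
  have "nrm (\<lambda>n m. T u n m - u n m) \<le> ennreal 0"
  proof (rule LIMSEQ_le_const[OF tend[of 0 "2 * q * (r / (1 - q))"]], intro exI allI impI)
    fix k
    have "nrm (\<lambda>n m. T u n m - u n m)
      = nrm (\<lambda>n m. (T u n m - T (U k) n m) + (- 1) * (u n m - U (Suc k) n m))"
      by (simp add: U_Suc)
    also have "\<dots> \<le> nrm (\<lambda>n m. T u n m - T (U k) n m)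
        + nrm (\<lambda>n m. (- 1) * (u n m - U (Suc k) n m))"
      by (rule nrm_add)
    also have "\<dots> \<le> nrm (\<lambda>n m. T u n m - T (U k) n m) + nrm (\<lambda>n m. u n m - U (Suc k) n m)"
      using nrm_scale[of "- 1" "\<lambda>n m. u n m - U (Suc k) n m"] by (intro add_left_mono) simp
    also have "\<dots> \<le> ennreal q * ennreal (q ^ k * r / (1 - q)) + ennreal (q ^ Suc k * r / (1 - q))"
      by (intro add_mono u_U order_trans[OF lip[OF u_r U_r]] mult_left_mono) auto
    also have "\<dots> = ennreal (q * (q ^ k * r / (1 - q)) + q ^ Suc k * r / (1 - q))"
      using q r by (simp flip: ennreal_plus ennreal_mult)
    also have "q * (q ^ k * r / (1 - q)) + q ^ Suc k * r / (1 - q) = 0 + q ^ k * (2 * q * (r / (1 - q)))"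
      by simp
    finally show "nrm (\<lambda>n m. T u n m - u n m) \<le> ennreal (0 + q ^ k * (2 * q * (r / (1 - q))))" .
  qed
  then have "T u = u"
    using nrm_eq_0_imp[of "\<lambda>n m. T u n m - u n m"] by (auto simp: fun_eq_iff)
  moreover have "P u"
  proof (rule P_lim[OF _ lim])
    show "P (U k)" for k
      by (induction k) (simp_all add: U_Suc P_step, simp add: U_def P0)
  qed
  ultimately show ?thesis
    using that u_r by blast
qed

end

section \<open>The nonlinear part of an analytic force\<close>

text \<open>The numbers \<open>h\<^sub>j\<close> are the Taylor coefficients with index \<open>j + 2\<close>. The summability condition comes from the
  series of the derivative, which has the same radius of convergence.\<close>

lemma analytic_quadratic_remainder:
  assumes "real_analytic_near F x"
  obtains h \<rho> where "0 < \<rho>"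
    and "summable (\<lambda>j. \<bar>h j\<bar> * (real (j + 2) * \<rho> ^ (j + 1)))"
    and "\<And>s. \<bar>s\<bar> \<le> \<rho> \<Longrightarrow>
      ((\<lambda>j. h j * s ^ (j + 2)) has_sum (F (x + s) - F x - deriv F x * s)) UNIV"
proof -
  obtain P where P: "(\<lambda>h. F (x + h)) has_fps_expansion P"
    using assms unfolding real_analytic_near_def by blast
  then have R: "fps_conv_radius P > 0"
    and ev: "eventually (\<lambda>z. eval_fps P z = F (x + z)) (nhds 0)"
    by (auto simp: has_fps_expansion_def)
  obtain d where d: "0 < d" and eq: "\<And>z. \<bar>z\<bar> < d \<Longrightarrow> eval_fps P z = F (x + z)"
    using ev by (auto simp: eventually_nhds_metric)
  have eval0: "eval_fps P 0 = F x" "fps_nth P 0 = F x"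
    using eq[of 0] d by (simp_all add: eval_fps_at_0)
  have "(eval_fps P has_field_derivative eval_fps (fps_deriv P) 0) (at 0)"
    using R by (intro has_field_derivative_eval_fps) (simp add: zero_ereal_def)
  then have "((\<lambda>z. F (x + z)) has_field_derivative fps_nth P 1) (at 0)"
    using ev by (subst DERIV_cong_ev[OF refl _ refl, symmetric])
      (auto simp: eval_fps_at_0)
  then have deriv: "deriv F x = fps_nth P 1"
    using DERIV_shift[of F _ 0 x] by (intro DERIV_imp_deriv) (simp add: add.commute)
  obtain e :: real where e: "0 < e" "ereal e < fps_conv_radius P"
    using R ereal_dense2 by (metis ereal_less(2))
  define \<rho> where "\<rho> = min e (d / 2)"
  have \<rho>: "0 < \<rho>" "\<rho> < d" "ereal \<rho> < fps_conv_radius P"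
    using d e by (auto simp: \<rho>_def min_def intro: order.strict_trans1[of _ "ereal e"])
  define h where "h j = fps_nth P (j + 2)" for j
  have "summable (\<lambda>n. norm (fps_nth (fps_deriv P) n * \<rho> ^ n))"
    using \<rho> by (intro norm_summable_fps order.strict_trans2[OF _ fps_conv_radius_deriv]) simp
  then have "summable (\<lambda>j. norm (fps_nth (fps_deriv P) (j + 1) * \<rho> ^ (j + 1)))"
    by (rule summable_ignore_initial_segment)
  then have "summable (\<lambda>j. \<bar>h j\<bar> * (real (j + 2) * \<rho> ^ (j + 1)))"
    using \<rho>(1) by (simp add: h_def abs_mult mult_ac)
  moreover have "((\<lambda>j. h j * s ^ (j + 2)) has_sum (F (x + s) - F x - deriv F x * s)) UNIV"
    if s: "\<bar>s\<bar> \<le> \<rho>" for s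
  proof -
    have s': "ereal (norm s) < fps_conv_radius P"
      using s \<rho>(3) by (simp add: le_less_trans[of _ "ereal \<rho>"])
    have "(\<lambda>n. fps_nth P n * s ^ n) sums F (x + s)"
      using sums_eval_fps[OF s'] eq[of s] s \<rho>(2) by simp
    then have "(\<lambda>j. fps_nth P (j + 2) * s ^ (j + 2)) sums
        (F (x + s) - (\<Sum>n<2. fps_nth P n * s ^ n))"
      by (subst sums_iff_shift) simp
    moreover have "(\<Sum>n<2. fps_nth P n * s ^ n) = F x + deriv F x * s"
      by (simp add: numeral_2_eq_2 eval0 deriv)
    ultimately have "(\<lambda>j. h j * s ^ (j + 2)) sums (F (x + s) - F x - deriv F x * s)"
      by (simp add: h_def diff_diff_eq)
    moreover have "summable (\<lambda>j. norm (h j * s ^ (j + 2)))"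
      using summable_ignore_initial_segment[OF norm_summable_fps[OF s'], of 2]
      by (simp add: h_def)
    ultimately show ?thesis
      by (intro norm_summable_imp_has_sum)
  qed
  ultimately show ?thesis
    using that \<rho>(1) by blast
qed

text \<open>Every term of the derivative of the majorant has a factor \<open>s\<close>, so its sum is at most \<open>s/\<rho>\<close> times its
  sum at \<open>\<rho>\<close>.\<close>

lemma small_lipschitz_constant:
  fixes h :: "nat \<Rightarrow> real"
  assumes "0 < \<rho>" and "0 < \<kappa>" and summ: "summable (\<lambda>j. \<bar>h j\<bar> * (real (j + 2) * \<rho> ^ (j + 1)))"
  obtains s L where "0 < s" "s \<le> \<rho>" "L \<le> \<kappa>" "0 \<le> L"
    and "(\<lambda>j. \<bar>h j\<bar> * (real (j + 2) * s ^ (j + 1))) sums L"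
proof -
  let ?t = "\<lambda>s j. \<bar>h j\<bar> * (real (j + 2) * s ^ (j + 1))"
  define M where "M = (\<Sum>j. ?t \<rho> j)"
  have M: "0 \<le> M"
    unfolding M_def using assms by (intro suminf_nonneg summ) simp
  define s where "s = \<rho> * min 1 (\<kappa> / (M + 1))"
  have s: "0 < s" "s \<le> \<rho>"
    using assms M by (auto simp: s_def mult_le_cancel_left1)
  have le: "?t s j \<le> s / \<rho> * ?t \<rho> j" for j
  proof -
    have "s ^ j \<le> \<rho> ^ j"
      using s by (intro power_mono) auto
    then have "s ^ (j + 1) \<le> s / \<rho> * \<rho> ^ (j + 1)"
      using s assms by simp
    then have "?t s j \<le> \<bar>h j\<bar> * (real (j + 2) * (s / \<rho> * \<rho> ^ (j + 1)))"
      by (intro mult_left_mono) auto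
    then show ?thesis by (simp only: mult_ac)
  qed
  have nonneg: "0 \<le> ?t s j" for j
    using s by simp
  have summ_s: "summable (?t s)"
    using le nonneg by (intro summable_comparison_test'[OF summable_mult[OF summ, of "s / \<rho>"], of 0])
      (metis abs_of_nonneg real_norm_def)
  have "suminf (?t s) \<le> (\<Sum>j. s / \<rho> * ?t \<rho> j)"
    by (intro suminf_le le summ_s summable_mult[OF summ])
  also have "\<dots> = s / \<rho> * M"
    unfolding M_def by (rule suminf_mult[OF summ])
  also have "\<dots> = min 1 (\<kappa> / (M + 1)) * M"
    using assms by (simp add: s_def)
  also have "\<dots> \<le> \<kappa> / (M + 1) * M"
    using M by (intro mult_right_mono) auto
  also have "\<dots> \<le> \<kappa>"
    using M assms by (simp add: field_simps)
  finally show ?thesis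
    using that s summable_sums[OF summ_s] suminf_nonneg[OF summ_s nonneg] by blast
qed

section \<open>The spectral gap above the band of linear waves\<close>

lemma m_zero_eq_0:
  assumes "0 < a" and "4 * a < \<gamma>\<^sup>2"
  shows "m_zero a \<gamma> = 0"
proof -
  have "{m::int. 0 \<le> (of_int m * \<gamma>)\<^sup>2 / a \<and> (of_int m * \<gamma>)\<^sup>2 / a \<le> 4} = {0}"
  proof -
    have "4 < (of_int m * \<gamma>)\<^sup>2 / a" if "m \<noteq> 0" for m :: int
    proof -
      have "1 * \<gamma>\<^sup>2 \<le> (of_int m)\<^sup>2 * \<gamma>\<^sup>2"
        using that by (intro mult_right_mono) (simp_all add: int_one_le_iff_zero_less flip: of_int_power)
      then show ?thesis
        using assms by (simp add: power_mult_distrib field_simps)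
    qed
    then show ?thesis
      using assms by (force simp: not_le[symmetric])
  qed
  then show ?thesis
    by (simp add: m_zero_def)
qed

text \<open>The number \<open>-z\<^sub>1 = 1/Z\<close> is the smaller root of \<open>z\<^sup>2 - \<delta>\<^sub>1 z + 1\<close>, so \<open>\<delta>\<^sub>1 = Z + 1/Z\<close> with \<open>Z > 1\<close>.
  The factor \<open>1/2\<close> in \<open>\<sigma>\<^sub>0\<close> gives \<open>E = e\<^bsup>\<sigma>\<^sub>0\<^esup> \<le> \<surd>Z < Z\<close>, and \<open>E \<mapsto> E + 1/E\<close> is strictly increasing on
  \<open>[1,\<infinity>)\<close>.\<close>

lemma sigma_zero_bounds:
  assumes "0 < a" and "4 * a < \<gamma>\<^sup>2"
  shows "0 < sigma_zero a \<gamma>"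
    and "exp (sigma_zero a \<gamma>) + exp (- sigma_zero a \<gamma>) < delta a \<gamma> 1"
proof -
  define d where "d = delta a \<gamma> 1"
  have d: "2 < d"
    using assms by (simp add: d_def delta_def field_simps)
  have d4: "0 < d\<^sup>2 / 4 - 1"
    using power_strict_mono[of 2 d 2] d by simp
  define q where "q = sqrt (d\<^sup>2 / 4 - 1)"
  have q: "0 < q" "q\<^sup>2 = d\<^sup>2 / 4 - 1"
    using d4 by (simp_all add: q_def)
  \<comment> \<open>the larger root of \<open>z\<^sup>2 - \<delta>\<^sub>1 z + 1\<close>\<close>
  define Z where "Z = d / 2 + q"
  have Z1: "1 < Z"
    using d q by (simp add: Z_def)
  have ZZ: "Z * (d / 2 - q) = 1"
    using q(2) by (simp add: Z_def power2_eq_square algebra_simps)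
  then have inv: "d / 2 - q = 1 / Z"
    using Z1 by (simp add: field_simps)
  have "z_root a \<gamma> 1 = - (1 / Z)"
    unfolding inv[symmetric] by (simp add: z_root_def d_def[symmetric] q_def)
  then have sz: "sigma_zero a \<gamma> = min 1 (ln Z / 2)"
    using Z1 by (simp add: sigma_zero_def m_zero_eq_0[OF assms] ln_div)
  show pos: "0 < sigma_zero a \<gamma>"
    using Z1 by (simp add: sz)
  define E where "E = exp (sigma_zero a \<gamma>)"
  have E1: "1 < E"
    using pos by (simp add: E_def)
  have "E\<^sup>2 \<le> Z"
  proof -
    have "E\<^sup>2 = exp (2 * sigma_zero a \<gamma>)"
      by (simp add: E_def exp_double)
    also have "\<dots> \<le> exp (ln Z)"
      by (simp add: sz)
    finally show ?thesis using Z1 by simp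
  qed
  moreover have "E * 1 < E * E"
    using E1 by (intro mult_strict_left_mono) auto
  ultimately have EZ: "E < Z"
    by (simp add: power2_eq_square)
  have "0 < (Z - E) * (1 - 1 / (E * Z))"
  proof (intro mult_pos_pos)
    have "1 * 1 < E * Z"
      using E1 Z1 by (intro mult_strict_mono) auto
    then show "0 < 1 - 1 / (E * Z)" by simp
  qed (use EZ in simp)
  also have "\<dots> = (Z + 1 / Z) - (E + 1 / E)"
    using E1 Z1 by (simp add: field_simps)
  also have "Z + 1 / Z = d"
    by (simp add: inv[symmetric]) (simp add: Z_def)
  finally show "exp (sigma_zero a \<gamma>) + exp (- sigma_zero a \<gamma>) < delta a \<gamma> 1"
    by (simp add: E_def d_def exp_minus field_simps)
qed

lemma delta_mono:
  assumes "0 < a" and "m \<noteq> 0"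
  shows "delta a \<gamma> 1 \<le> delta a \<gamma> m"
proof -
  have "1 * \<gamma>\<^sup>2 \<le> (of_int m)\<^sup>2 * \<gamma>\<^sup>2"
    using assms(2) by (intro mult_right_mono) (simp_all add: int_one_le_iff_zero_less flip: of_int_power)
  then show ?thesis
    using assms(1) by (simp add: delta_def power_mult_distrib divide_right_mono)
qed

section \<open>The lattice equation as a fixed point problem\<close>

text \<open>The elongation \<open>y\<^sub>n - y\<^sub>n\<^sub>+\<^sub>1\<close> of the spring between the particles \<open>n\<close> and \<open>n + 1\<close>, relative to the
  equilibrium \<open>-c\<close>. Replacing \<open>v(n,0)\<close> by \<open>v(n,0)\<close> plus a constant does not change it.\<close>

definition strain :: "(nat \<Rightarrow> int \<Rightarrow> complex) \<Rightarrow> nat \<Rightarrow> int \<Rightarrow> complex"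
  where "strain u n m = u n m - u (Suc n) m"

definition force :: "(nat \<Rightarrow> real) \<Rightarrow> (nat \<Rightarrow> int \<Rightarrow> complex) \<Rightarrow> nat \<Rightarrow> int \<Rightarrow> complex"
  where "force h u n = pseries h (strain u n)"

text \<open>The map whose fixed points are the coefficients of the motion: the mode equation solved for its middle
  term, the summed equation in the mode \<open>0\<close>, and the coefficients \<open>\<beta>\<close> of the driver as boundary values. In
  the mode \<open>0\<close> there is no boundary value: this mode is normalised to vanish as \<open>n \<rightarrow> \<infinity>\<close>, and the term
  \<open>\<epsilon> b\<^sub>0 - v(0,0)\<close> in the motion compensates for it.\<close>

fun step :: "real \<Rightarrow> real \<Rightarrow> (nat \<Rightarrow> real) \<Rightarrow> (int \<Rightarrow> complex) \<Rightarrow>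
    (nat \<Rightarrow> int \<Rightarrow> complex) \<Rightarrow> nat \<Rightarrow> int \<Rightarrow> complex"
  where "step a \<gamma> h \<beta> u n m =
    (if m = 0 then u (Suc n) 0 - force h u n 0 / of_real a
     else case n of 0 \<Rightarrow> \<beta> m
       | Suc k \<Rightarrow> - ((force h u k m - force h u n m) / of_real a + u (Suc n) m + u k m)
                   / of_real (delta a \<gamma> m))"

lemma delta_uminus: "delta a \<gamma> (- m) = delta a \<gamma> m"
  by (simp add: delta_def)

lemma hermitian_step:
  assumes \<beta>: "hermitian \<beta>" and u: "\<And>n. hermitian (u n)"
  shows "hermitian (step a \<gamma> h \<beta> u n)"
proof -
  have "hermitian (force h u n)" for n
    unfolding force_def using u by (intro hermitian_pseries) (simp add: hermitian_def strain_def)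
  then show ?thesis
    using \<beta> u unfolding hermitian_def
    by (auto simp: delta_uminus split: nat.split)
       (metis minus_zero)+
qed

lemma pseries_zero: "pseries h (\<lambda>_. 0) m = 0"
proof -
  have "cpow (\<lambda>_. 0) j = (\<lambda>_. 0)" for j
    by (cases j) (simp_all add: conv_def fun_eq_iff)
  then show ?thesis
    by (simp add: pseries_def del: cpow.simps)
qed

context weighted
begin

lemma nrm_strain: "nrm (strain u) \<le> 2 * nrm u"
proof -
  have "ennreal (exp (\<sigma> * real n) * cmod (strain u n m)) \<le> 2 * env u m + 0 * env u m" for n m
  proof -
    have "exp (\<sigma> * real n) * cmod (strain u n m)
      \<le> exp (\<sigma> * real n) * cmod (u n m) + exp (\<sigma> * real n) * cmod (u (Suc n) m)"
      by (simp add: strain_def norm_triangle_ineq4 flip: distrib_left)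
    also have "\<dots> \<le> exp (\<sigma> * real n) * cmod (u n m) + exp (\<sigma> * real (Suc n)) * cmod (u (Suc n) m)"
      using sigma_nonneg by (intro add_left_mono mult_right_mono) (auto simp: mult_left_mono)
    finally have "ennreal (exp (\<sigma> * real n) * cmod (strain u n m))
      \<le> ennreal (exp (\<sigma> * real n) * cmod (u n m)) + ennreal (exp (\<sigma> * real (Suc n)) * cmod (u (Suc n) m))"
      by (simp add: ennreal_leI flip: ennreal_plus)
    also have "\<dots> \<le> env u m + env u m"
      by (intro add_mono env_upper)
    finally show ?thesis by (simp add: mult_2)
  qed
  from nrm_le_lincomb[OF this] show ?thesis by simp
qed

text \<open>The linear part alone has the Lipschitz constant \<open>q\<close>. The factor \<open>exp (- \<sigma>)\<close> belongs to the mode \<open>0\<close>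
  and the other one to the modes \<open>m \<noteq> 0\<close>; likewise for the two lower bounds of \<open>K\<close>.\<close>

lemma step_lipschitz:
  fixes u v :: "nat \<Rightarrow> int \<Rightarrow> complex" and h :: "nat \<Rightarrow> real"
  defines "du \<equiv> (\<lambda>n m. u n m - v n m)"
    and "dW \<equiv> (\<lambda>n m. force h u n m - force h v n m)"
  assumes a: "0 < a" and d: "0 < d" "\<And>m. m \<noteq> 0 \<Longrightarrow> d \<le> delta a \<gamma> m"
    and q: "exp (- \<sigma>) \<le> q" "(exp \<sigma> + exp (- \<sigma>)) / d \<le> q"
    and K: "1 / a \<le> K" "(exp \<sigma> + 1) / (a * d) \<le> K"
  shows "nrm (\<lambda>n m. step a \<gamma> h \<beta> u n m - step a \<gamma> h \<beta> v n m) \<le> ennreal q * nrm du + ennreal K * nrm dW"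
proof (rule nrm_le_lincomb)
  fix n m
  have q0: "0 < q" and K0: "0 < K"
    using q(1) K(1) a by (auto intro: less_le_trans[of _ "exp (- \<sigma>)"] less_le_trans[of _ "1 / a"])
  let ?E = "exp (\<sigma> * real n)"
  let ?D = "step a \<gamma> h \<beta> u n m - step a \<gamma> h \<beta> v n m"
  show "ennreal (?E * cmod ?D) \<le> ennreal q * env du m + ennreal K * env dW m"
  proof (cases "env du m = top \<or> env dW m = top")
    case True
    then show ?thesis
      using q0 K0 by (auto simp: ennreal_mult_top)
  next
    case False
    then obtain A B where A: "0 \<le> A" "env du m = ennreal A" and B: "0 \<le> B" "env dW m = ennreal B"
      by (metis ennreal_cases)
    have x: "exp (\<sigma> * real n) * cmod (du n m) \<le> A" for n
      using env_upper[of n du m] A by simp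
    have y: "exp (\<sigma> * real n) * cmod (dW n m) \<le> B" for n
      using env_upper[of n dW m] B by simp
    have "?E * cmod ?D \<le> q * A + K * B"
    proof (cases "m = 0")
      case True
      have "?E * cmod ?D = ?E * cmod (du (Suc n) m - dW n m / of_real a)"
        using True by (simp add: du_def dW_def diff_divide_distrib algebra_simps)
      also have "\<dots> \<le> ?E * (cmod (du (Suc n) m) + cmod (dW n m / of_real a))"
        by (intro mult_left_mono norm_triangle_ineq4) simp
      also have "\<dots> = exp (- \<sigma>) * (exp (\<sigma> * real (Suc n)) * cmod (du (Suc n) m))
          + 1 / a * (?E * cmod (dW n m))"
        using a by (simp add: norm_divide distrib_left exp_add exp_minus field_simps)
      also have "\<dots> \<le> q * A + K * B"
        using q0 K0 by (intro add_mono mult_mono x y q K) auto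
      finally show ?thesis .
    next
      case m: False
      show ?thesis
      proof (cases n)
        case 0
        then show ?thesis
          using m q0 K0 A B by simp
      next
        case (Suc k)
        let ?dl = "delta a \<gamma> m"
        have dl: "0 < ?dl" "d \<le> ?dl"
          using d m by force+
        have "?E * cmod ?D
          = ?E * cmod (- ((dW k m - dW n m) / of_real a + du (Suc n) m + du k m) / of_real ?dl)"
        proof -
          have "?D = - ((dW k m - dW n m) / of_real a + du (Suc n) m + du k m) / of_real ?dl"
            using m Suc by (simp add: du_def dW_def diff_divide_distrib add_divide_distrib algebra_simps)
          then show ?thesis by simp
        qed
        also have "\<dots> = ?E * cmod ((dW k m - dW n m) / of_real a + du (Suc n) m + du k m) / ?dl"
          using dl by (simp add: norm_divide del: minus_add_distrib)
        also have "\<dots> \<le> ?E * cmod ((dW k m - dW n m) / of_real a + du (Suc n) m + du k m) / d"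
          using dl d(1) by (intro divide_left_mono) auto
        also have "\<dots> \<le> ?E * ((cmod (dW k m) + cmod (dW n m)) / a + cmod (du (Suc n) m) + cmod (du k m)) / d"
        proof -
          have "cmod ((dW k m - dW n m) / of_real a) \<le> (cmod (dW k m) + cmod (dW n m)) / a"
            using a by (simp add: norm_divide divide_right_mono norm_triangle_ineq4)
          then have "cmod ((dW k m - dW n m) / of_real a + du (Suc n) m + du k m)
              \<le> (cmod (dW k m) + cmod (dW n m)) / a + cmod (du (Suc n) m) + cmod (du k m)"
            by (intro norm_add_rule_thm) auto
          then show ?thesis
            using d(1) by (intro divide_right_mono mult_left_mono) auto
        qed
        also have "\<dots> = (exp (- \<sigma>) * (exp (\<sigma> * real (Suc n)) * cmod (du (Suc n) m))
            + exp \<sigma> * (exp (\<sigma> * real k) * cmod (du k m))) / d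
            + (exp \<sigma> * (exp (\<sigma> * real k) * cmod (dW k m)) + ?E * cmod (dW n m)) / (a * d)"
        proof -
          have "exp (\<sigma> * 2) = exp \<sigma> * exp \<sigma>"
            by (simp flip: exp_add)
          then show ?thesis
            using a d(1) by (simp add: Suc exp_add exp_minus field_simps)
        qed
        also have "\<dots> \<le> (exp (- \<sigma>) * A + exp \<sigma> * A) / d + (exp \<sigma> * B + B) / (a * d)"
          using a d(1) by (intro add_mono divide_right_mono mult_left_mono x y) auto
        also have "\<dots> = (exp \<sigma> + exp (- \<sigma>)) / d * A + (exp \<sigma> + 1) / (a * d) * B"
          by (simp add: field_simps)
        also have "\<dots> \<le> q * A + K * B"
          using A B by (intro add_mono mult_right_mono q K)
        finally show ?thesis .
      qed
    qed
    then have "ennreal (?E * cmod ?D) \<le> ennreal (q * A + K * B)"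
      by (rule ennreal_leI)
    also have "\<dots> = ennreal q * env du m + ennreal K * env dW m"
      using A B q0 K0 by (simp add: ennreal_mult)
    finally show ?thesis .
  qed
qed

text \<open>On the ball of radius \<open>r = s/2\<close> the strain stays in the ball of radius \<open>s\<close>, where the nonlinear force
  has the Lipschitz constant \<open>L\<close>. With \<open>2 K L \<le> (1 - q)/2\<close> the whole map has the contraction factor
  \<open>q' = (1 + q)/2\<close>. As the force of the zero sequence vanishes, the norm of the image of zero is at most the
  norm of the driver, and a driver of size \<open>(1 - q') r\<close> keeps the ball invariant.\<close>

lemma small_fixed_points:
  assumes a: "0 < a" and sigma_pos: "0 < \<sigma>" and gap: "exp \<sigma> + exp (- \<sigma>) < delta a \<gamma> 1"
    and rho: "0 < \<rho>" and summ: "summable (\<lambda>j. \<bar>h j\<bar> * (real (j + 2) * \<rho> ^ (j + 1)))"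
  obtains \<eta> where "0 < \<eta>"
    and "\<And>\<beta>. hermitian \<beta> \<Longrightarrow> esum (\<lambda>m. ennreal (w m) * ennreal (cmod (\<beta> m))) \<le> ennreal \<eta> \<Longrightarrow>
      \<exists>v. nrm v < \<infinity> \<and> (\<forall>n. hermitian (v n)) \<and> step a \<gamma> h \<beta> v = v \<and>
        (\<forall>n. l1norm (strain v n) \<le> ennreal \<rho>)"
proof -
  define d where "d = delta a \<gamma> 1"
  have d: "0 < d"
    unfolding d_def by (rule le_less_trans[OF _ gap]) (simp add: add_nonneg_nonneg)
  define q where "q = max (exp (- \<sigma>)) ((exp \<sigma> + exp (- \<sigma>)) / d)"
  define K where "K = max (1 / a) ((exp \<sigma> + 1) / (a * d))"
  have q: "0 < q" "q < 1"
    using sigma_pos gap d by (auto simp: q_def d_def less_max_iff_disj)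
  have K: "0 < K"
    using a by (simp add: K_def less_max_iff_disj)
  obtain s L where s: "0 < s" "s \<le> \<rho>" and L: "L \<le> (1 - q) / (4 * K)" "0 \<le> L"
    and sums: "(\<lambda>j. \<bar>h j\<bar> * (real (j + 2) * s ^ (j + 1))) sums L"
    using small_lipschitz_constant[OF rho _ summ, of "(1 - q) / (4 * K)"] q K by auto
  define r where "r = s / 2"
  define q' where "q' = (1 + q) / 2"
  have q': "0 \<le> q'" "q' < 1"
    using q by (simp_all add: q'_def)
  have r: "0 < r"
    using s by (simp add: r_def)
  have strain_s: "nrm (strain u) \<le> ennreal s" if "nrm u \<le> ennreal r" for u
  proof -
    have "nrm (strain u) \<le> ennreal 2 * ennreal r"
      using order_trans[OF nrm_strain mult_left_mono[OF that, of 2]] by simp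
    also have "\<dots> = ennreal s"
      using r by (subst ennreal_mult[symmetric]) (auto simp: r_def)
    finally show ?thesis .
  qed
  have lip: "nrm (\<lambda>n m. step a \<gamma> h \<beta> u n m - step a \<gamma> h \<beta> v n m)
      \<le> ennreal q' * nrm (\<lambda>n m. u n m - v n m)"
    if u: "nrm u \<le> ennreal r" and v: "nrm v \<le> ennreal r" for u v \<beta>
  proof -
    let ?d = "nrm (\<lambda>n m. u n m - v n m)"
    have "nrm (\<lambda>n m. step a \<gamma> h \<beta> u n m - step a \<gamma> h \<beta> v n m)
      \<le> ennreal q * ?d + ennreal K * nrm (\<lambda>n m. force h u n m - force h v n m)"
      using a d by (intro step_lipschitz[where d = d]) (auto simp: q_def K_def d_def delta_mono)
    also have "nrm (\<lambda>n m. force h u n m - force h v n m)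
      \<le> ennreal L * nrm (\<lambda>n m. strain u n m - strain v n m)"
      unfolding force_def using s by (intro nrm_pseries_diff[OF _ _ _ sums] strain_s u v) simp
    also have "(\<lambda>n m. strain u n m - strain v n m) = strain (\<lambda>n m. u n m - v n m)"
      by (simp add: strain_def fun_eq_iff)
    also have "nrm \<dots> \<le> 2 * ?d"
      by (rule nrm_strain)
    also have "ennreal q * ?d + ennreal K * (ennreal L * (2 * ?d)) = ennreal (q + K * (L * 2)) * ?d"
      using q K L by (simp add: ennreal_mult ennreal_plus distrib_right mult.assoc)
    also have "\<dots> \<le> ennreal q' * ?d"
    proof (intro mult_right_mono ennreal_leI)
      have "K * (L * 2) \<le> K * ((1 - q) / (4 * K) * 2)"
        using K L by (intro mult_left_mono mult_right_mono) auto
      also have "\<dots> = (1 - q) / 2"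
        using K by (simp add: field_simps)
      finally show "q + K * (L * 2) \<le> q'"
        by (simp add: q'_def field_simps)
    qed simp
    finally show ?thesis
      by (simp add: mult_left_mono add_left_mono)
  qed
  show ?thesis
  proof
    show "0 < (1 - q') * r"
      using q' r by simp
  next
    fix \<beta>
    assume herm: "hermitian \<beta>"
      and small: "esum (\<lambda>m. ennreal (w m) * ennreal (cmod (\<beta> m))) \<le> ennreal ((1 - q') * r)"
    let ?T = "step a \<gamma> h \<beta>"
    have "nrm (?T (\<lambda>_ _. 0)) \<le> esum (\<lambda>m. ennreal (w m) * ennreal (cmod (\<beta> m)))"
      by (rule nrm_le) (simp add: force_def strain_def[abs_def] pseries_zero split: nat.split)
    note T0 = order_trans[OF this small]
    show "\<exists>v. nrm v < \<infinity> \<and> (\<forall>n. hermitian (v n)) \<and> ?T v = v \<and> (\<forall>n. l1norm (strain v n) \<le> ennreal \<rho>)"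
    proof (rule contraction_fixed_point[OF less_imp_le[OF r] q' T0 lip, where P = "\<lambda>u. \<forall>n. hermitian (u n)"])
      show "\<forall>n. hermitian (u n)"
        if U: "\<And>k. \<forall>n. hermitian (U k n)" and lim: "\<And>n m. (\<lambda>k. U k n m) \<longlonglongrightarrow> u n m" for U u
        unfolding hermitian_def
      proof (intro allI)
        fix n m
        have "(\<lambda>k. U k n (- m)) \<longlonglongrightarrow> cnj (u n m)"
          using U lim[of n m] by (simp add: hermitian_def tendsto_cnj)
        then show "u n (- m) = cnj (u n m)"
          using LIMSEQ_unique lim by blast
      qed
      fix v assume v: "nrm v \<le> ennreal r" "\<forall>n. hermitian (v n)" "?T v = v"
      have "l1norm (strain v n) \<le> ennreal \<rho>" for n
        using order_trans[OF l1norm_le_nrm strain_s[OF v(1)]] s by (meson ennreal_leI order_trans)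
      moreover have "nrm v < \<infinity>"
        using le_less_trans[OF v(1)] by simp
      ultimately show ?thesis
        using v by blast
    qed (use herm in \<open>auto intro: hermitian_step simp: hermitian_def[of "\<lambda>_. 0"] simp del: step.simps\<close>)
  qed
qed

end

section \<open>From Fourier coefficients to motions of the lattice\<close>

text \<open>In the mode \<open>0\<close> both sides vanish, since \<open>a\<close> times the strain plus the nonlinear force is zero at every
  site.\<close>

lemma step_fixed_point_equation:
  assumes "0 < a" and "\<And>m. m \<noteq> 0 \<Longrightarrow> delta a \<gamma> m \<noteq> 0" and fixp: "step a \<gamma> h \<beta> v = v"
  shows "- of_real ((of_int m * \<gamma>)\<^sup>2) * v (Suc n) m =
    of_real a * (strain v n m - strain v (Suc n) m) + (force h v n m - force h v (Suc n) m)"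
proof (cases "m = 0")
  case True
  have "strain v n 0 = - force h v n 0 / of_real a" for n
    using fun_cong[OF fun_cong[OF fixp, of n], of 0] by (simp add: strain_def algebra_simps)
  then show ?thesis
    using True assms(1) by (simp add: field_simps)
next
  case False
  let ?A = "complex_of_real a"
  have A: "?A \<noteq> 0"
    using assms(1) by simp
  have "- ((force h v n m - force h v (Suc n) m) / ?A + v (Suc (Suc n)) m + v n m)
      / of_real (delta a \<gamma> m) = v (Suc n) m"
    using fun_cong[OF fun_cong[OF fixp, of "Suc n"], of m] False by simp
  then have eq: "- ((force h v n m - force h v (Suc n) m) / ?A + v (Suc (Suc n)) m + v n m)
      = of_real (delta a \<gamma> m) * v (Suc n) m"
    using assms(2)[OF False] by (metis mult.commute nonzero_divide_eq_eq of_real_eq_0_iff)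
  have "a * delta a \<gamma> m = (of_int m * \<gamma>)\<^sup>2 - 2 * a"
    using assms(1) by (simp add: delta_def right_diff_distrib)
  then have "?A * of_real (delta a \<gamma> m) = of_real ((of_int m * \<gamma>)\<^sup>2) - 2 * ?A"
    by (metis of_real_diff of_real_mult of_real_numeral)
  then have "(of_real ((of_int m * \<gamma>)\<^sup>2) - 2 * ?A) * v (Suc n) m
      = ?A * (of_real (delta a \<gamma> m) * v (Suc n) m)"
    by (simp only: mult.assoc[symmetric])
  also have "\<dots> = - ((force h v n m - force h v (Suc n) m) + ?A * (v (Suc (Suc n)) m + v n m))"
    unfolding eq[symmetric] using A by (simp add: field_simps)
  finally have "(of_real ((of_int m * \<gamma>)\<^sup>2) - 2 * ?A) * v (Suc n) m
      = - ((force h v n m - force h v (Suc n) m) + ?A * (v (Suc (Suc n)) m + v n m))" .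
  then show ?thesis
    by (simp add: strain_def algebra_simps del: of_real_power of_real_mult)
qed

text \<open>The mode equation gives the summability of \<open>m\<^sup>2 v(n,m)\<close>, \<open>n \<ge> 1\<close>, which makes two termwise derivatives
  legitimate: the solution is regular although the driver need not be.\<close>

lemma fixed_point_solves_lattice:
  assumes a: "0 < deriv F (- c)" and \<gamma>: "0 < \<gamma>"
    and delta: "\<And>m. m \<noteq> 0 \<Longrightarrow> delta (deriv F (- c)) \<gamma> m \<noteq> 0"
    and fixp: "step (deriv F (- c)) \<gamma> h \<beta> v = v"
    and herm: "\<And>n. hermitian (v n)" and l1: "\<And>n. l1norm (v n) < \<infinity>"
    and rho: "0 < \<rho>" and small: "\<And>n. l1norm (strain v n) \<le> ennreal \<rho>"
    and summ: "summable (\<lambda>j. \<bar>h j\<bar> * (real (j + 2) * \<rho> ^ (j + 1)))"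
    and expansion: "\<And>s. \<bar>s\<bar> \<le> \<rho> \<Longrightarrow>
      ((\<lambda>j. h j * s ^ (j + 2)) has_sum (F (- c + s) - F (- c) - deriv F (- c) * s)) UNIV"
  shows "lattice_solution F (\<lambda>n t. c * real n + C + Re (trig (v n) (\<gamma> * t)))"
proof -
  let ?a = "deriv F (- c)"
  define X where "X n t = Re (trig (v n) (\<gamma> * t))" for n t
  define S where "S n t = Re (trig (strain v n) (\<gamma> * t))" for n t
  define W where "W n t = Re (trig (force h v n) (\<gamma> * t))" for n t
  have summ': "summable (\<lambda>j. \<bar>h j\<bar> * \<rho> ^ (j + 2))"
  proof (rule summable_comparison_test'[OF summable_mult[OF summ, of \<rho>], of 0])
    fix j :: nat
    have "\<bar>h j\<bar> * \<rho> ^ (j + 2) * 1 \<le> \<bar>h j\<bar> * \<rho> ^ (j + 2) * real (j + 2)"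
      using rho by (intro mult_left_mono) auto
    then show "norm (\<bar>h j\<bar> * \<rho> ^ (j + 2)) \<le> \<rho> * (\<bar>h j\<bar> * (real (j + 2) * \<rho> ^ (j + 1)))"
      using rho by (simp add: mult_ac)
  qed
  have l1_force: "l1norm (force h v n) < \<infinity>" for n
    unfolding force_def using trig_pseries(2)[OF small _ summ'] rho by simp
  have l1_strain: "l1norm (strain v n) < \<infinity>" for n
    using small[of n] le_less_trans by fastforce
  have S_eq: "S n t = X n t - X (Suc n) t" for n t
    by (simp add: S_def X_def strain_def[abs_def] trig_diff[OF l1 l1])
  have F_eq: "F (- c + S n t) = F (- c) + ?a * S n t + W n t" for n t
  proof -
    have herm_S: "hermitian (strain v n)"
      using herm by (simp add: hermitian_def strain_def)
    then have S: "trig (strain v n) (\<gamma> * t) = of_real (S n t)"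
      using trig_real by (simp add: S_def of_real_Re)
    have "ennreal \<bar>S n t\<bar> \<le> ennreal \<rho>"
      using order_trans[OF cmod_trig_le small] S by (metis norm_of_real)
    then have "\<bar>S n t\<bar> \<le> \<rho>"
      using rho by simp
    then have "((\<lambda>j. of_real (h j * S n t ^ (j + 2))) has_sum
        complex_of_real (F (- c + S n t) - F (- c) - ?a * S n t)) UNIV"
      by (intro has_sum_of_real expansion)
    then have "trig (force h v n) (\<gamma> * t) = of_real (F (- c + S n t) - F (- c) - ?a * S n t)"
      unfolding force_def using trig_pseries(1)[OF small _ summ', of n] rho S
      by (simp add: infsumI)
    then show ?thesis
      by (simp add: W_def)
  qed
  have mode: "- of_real ((of_int m * \<gamma>)\<^sup>2) * v (Suc n) m =
      of_real ?a * (strain v n m - strain v (Suc n) m) + (force h v n m - force h v (Suc n) m)" for n m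
    by (rule step_fixed_point_equation[OF a delta fixp])
  let ?acc = "\<lambda>n m. - of_real ((of_int m * \<gamma>)\<^sup>2) * v (Suc n) m"
  have l1_acc: "l1norm (?acc n) < \<infinity>" for n
    unfolding mode by (intro l1_add l1_scale l1_diff l1_strain l1_force)
  have acc_trig: "Re (trig (?acc n) (\<gamma> * t)) = ?a * (S n t - S (Suc n) t) + (W n t - W (Suc n) t)" for n t
    unfolding mode trig_add[OF l1_scale[OF l1_diff[OF l1_strain l1_strain]] l1_diff[OF l1_force l1_force]]
      trig_scale trig_diff[OF l1_strain l1_strain] trig_diff[OF l1_force l1_force]
    by (simp add: S_def W_def)
  have l1_1: "l1norm (\<lambda>m. of_int m * v (Suc n) m) < \<infinity>"
    and l1_2: "l1norm (\<lambda>m. of_int m * (\<i> * of_real \<gamma> * (of_int m * v (Suc n) m))) < \<infinity>" for n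
  proof -
    have "l1norm (\<lambda>m. of_int m * v (Suc n) m) \<le> l1norm (\<lambda>m. of_real (1 / \<gamma>\<^sup>2) * ?acc n m)"
    proof (intro nn_integral_mono ennreal_leI)
      fix m :: int
      have "real_of_int \<bar>m\<bar> \<le> (of_int m)\<^sup>2"
      proof -
        have "\<bar>m\<bar> * 1 \<le> \<bar>m\<bar> * \<bar>m\<bar>"
          by (cases "m = 0") (simp, intro mult_left_mono, auto)
        then have "\<bar>m\<bar> \<le> m\<^sup>2"
          by (simp add: power2_eq_square abs_mult_self_eq)
        then show ?thesis
          by (metis of_int_le_iff of_int_power)
      qed
      then have "\<bar>of_int m\<bar> * cmod (v (Suc n) m) \<le> (of_int m)\<^sup>2 * cmod (v (Suc n) m)"
        by (intro mult_right_mono) auto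
      then show "cmod (of_int m * v (Suc n) m) \<le> cmod (of_real (1 / \<gamma>\<^sup>2) * ?acc n m)"
        using \<gamma> by (simp add: norm_mult norm_power norm_divide power_mult_distrib)
    qed
    then show "l1norm (\<lambda>m. of_int m * v (Suc n) m) < \<infinity>"
      by (rule le_less_trans[OF _ l1_scale[OF l1_acc]])
    have eq: "of_int m * (\<i> * of_real \<gamma> * (of_int m * v (Suc n) m))
        = (- \<i> / of_real \<gamma>) * ?acc n m" for m
      using \<gamma> by (simp add: power2_eq_square field_simps)
    show "l1norm (\<lambda>m. of_int m * (\<i> * of_real \<gamma> * (of_int m * v (Suc n) m))) < \<infinity>"
      unfolding eq by (rule l1_scale[OF l1_acc])
  qed
  have l1_v: "l1norm (\<lambda>m. \<i> * of_real \<gamma> * (of_int m * v (Suc n) m)) < \<infinity>" for n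
    by (rule l1_scale[OF l1_1])
  let ?V = "\<lambda>n t. Re (trig (\<lambda>m. \<i> * of_real \<gamma> * (of_int m * v (Suc n) m)) (\<gamma> * t))"
  have "((\<lambda>t. c * real (Suc n) + C + X (Suc n) t) has_real_derivative ?V n t) (at t)" for n t
    unfolding X_def using DERIV_add[OF DERIV_const[of "c * real (Suc n) + C"]
      Re_trig_has_derivative[OF l1 l1_1, of n \<gamma> t]]
    by (simp only: add_0)
  moreover have "(?V n has_real_derivative
      F (c * real n + C + X n t - (c * real (Suc n) + C + X (Suc n) t))
      - F (c * real (Suc n) + C + X (Suc n) t - (c * real (Suc (Suc n)) + C + X (Suc (Suc n)) t))) (at t)" for n t
  proof -
    have eq: "(\<lambda>m. \<i> * of_real \<gamma> * (of_int m * (\<i> * of_real \<gamma> * (of_int m * v (Suc n) m)))) = ?acc n"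
      by (simp add: fun_eq_iff power2_eq_square mult_ac)
    have "c * real n + C + X n t - (c * real (Suc n) + C + X (Suc n) t) = - c + S n t" for n
      by (simp add: S_eq algebra_simps)
    then have "F (c * real n + C + X n t - (c * real (Suc n) + C + X (Suc n) t))
      - F (c * real (Suc n) + C + X (Suc n) t - (c * real (Suc (Suc n)) + C + X (Suc (Suc n)) t))
      = Re (trig (?acc n) (\<gamma> * t))"
      unfolding acc_trig by (simp only: F_eq) (simp add: algebra_simps)
    then show ?thesis
      using Re_trig_has_derivative[OF l1_v l1_2, of n \<gamma> t] unfolding eq by simp
  qed
  ultimately show ?thesis
    unfolding lattice_solution_def X_def[symmetric]
  proof (intro allI impI)
    fix n :: nat
    assume "1 \<le> n"
    then obtain k where n: "n = Suc k"
      by (cases n) auto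
    assume d1: "\<And>n t. ((\<lambda>t. c * real (Suc n) + C + X (Suc n) t) has_real_derivative ?V n t) (at t)"
      and d2: "\<And>n t. (?V n has_real_derivative
        F (c * real n + C + X n t - (c * real (Suc n) + C + X (Suc n) t))
        - F (c * real (Suc n) + C + X (Suc n) t - (c * real (Suc (Suc n)) + C + X (Suc (Suc n)) t))) (at t)"
    show "\<exists>x'. \<forall>t. ((\<lambda>t. c * real n + C + X n t) has_real_derivative x' t) (at t) \<and>
      (x' has_real_derivative
        F (c * real (n - 1) + C + X (n - 1) t - (c * real n + C + X n t))
        - F (c * real n + C + X n t - (c * real (n + 1) + C + X (n + 1) t))) (at t)"
      using d1[of k] d2[of k] by (intro exI[of _ "?V k"]) (simp add: n)
  qed
qed

theorem theorem20:
  fixes F :: "real \<Rightarrow> real" and c \<gamma> :: real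
    and w :: "int \<Rightarrow> real" and b :: "int \<Rightarrow> complex"
  assumes "real_analytic_near F (- c)"
    and "deriv F (- c) > 0"
    and "\<gamma> > 0"
    and "\<forall>m::int. (of_int m * \<gamma>)\<^sup>2 / deriv F (- c) \<noteq> 4"
    and "admissible_weight w"
    and "((\<lambda>m. w m * cmod (b m)) has_sum 1) UNIV"
    and "\<forall>m. b (- m) = cnj (b m)"
    and "\<gamma>\<^sup>2 > 4 * deriv F (- c)"
  shows "0 < sigma_zero (deriv F (- c)) \<gamma> \<and>
    (\<exists>D::real set. 0 \<in> interior D \<and>
      (\<forall>\<epsilon>\<in>D. \<exists>v \<in> weighted_space (sigma_zero (deriv F (- c)) \<gamma>) w.
        \<exists>x :: nat \<Rightarrow> real \<Rightarrow> real.
          (\<forall>t. complex_of_real (x 0 t) =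
             of_real \<epsilon> * (\<Sum>\<^sub>\<infinity>m. b m * exp (\<i> * of_real (\<gamma> * of_int m * t)))) \<and>
          (\<forall>n\<ge>1. \<forall>t. complex_of_real (x n t) =
             of_real (c * real n) + of_real \<epsilon> * b 0 - v 0 0
               + (\<Sum>\<^sub>\<infinity>m. v n m * exp (\<i> * of_real (of_int m * \<gamma> * t)))) \<and>
          time_periodic x \<and>
          lattice_solution F x))"
proof -
  let ?a = "deriv F (- c)"
  let ?\<sigma> = "sigma_zero ?a \<gamma>"
  note a = \<open>0 < ?a\<close> and \<gamma> = \<open>0 < \<gamma>\<close>
  have sigma: "0 < ?\<sigma>" "exp ?\<sigma> + exp (- ?\<sigma>) < delta ?a \<gamma> 1"
    by (rule sigma_zero_bounds; use assms in simp)+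
  interpret weighted ?\<sigma> w
    using sigma(1) assms(5) by unfold_locales auto
  obtain h \<rho> where rho: "0 < \<rho>"
    and summ: "summable (\<lambda>j. \<bar>h j\<bar> * (real (j + 2) * \<rho> ^ (j + 1)))"
    and expansion: "\<And>s. \<bar>s\<bar> \<le> \<rho> \<Longrightarrow>
      ((\<lambda>j. h j * s ^ (j + 2)) has_sum (F (- c + s) - F (- c) - ?a * s)) UNIV"
    by (rule analytic_quadratic_remainder[OF assms(1)], rule that)
  obtain \<eta> where \<eta>: "0 < \<eta>"
    and ex: "\<And>\<beta>. hermitian \<beta> \<Longrightarrow> esum (\<lambda>m. ennreal (w m) * ennreal (cmod (\<beta> m))) \<le> ennreal \<eta> \<Longrightarrow>
      \<exists>v. nrm v < \<infinity> \<and> (\<forall>n. hermitian (v n)) \<and> step ?a \<gamma> h \<beta> v = v \<and>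
        (\<forall>n. l1norm (strain v n) \<le> ennreal \<rho>)"
    by (rule small_fixed_points[OF a sigma rho summ], rule that)
  have w0: "0 \<le> w m" for m
    using weight_ge_1[of m] by simp
  have b1: "esum (\<lambda>m. ennreal (w m * cmod (b m))) = 1"
    using esum_eq_infsum[OF has_sum_imp_summable[OF assms(6)]] infsumI[OF assms(6)] w0 by simp
  have l1_b: "l1norm b < \<infinity>"
  proof -
    have "l1norm b \<le> esum (\<lambda>m. ennreal (w m * cmod (b m)))"
      using weight_ge_1 by (intro nn_integral_mono ennreal_leI) (simp add: mult_le_cancel_right1)
    then show ?thesis
      using b1 le_less_trans by fastforce
  qed
  have delta_nz: "delta ?a \<gamma> m \<noteq> 0" if "m \<noteq> 0" for m
  proof -
    have "0 < exp ?\<sigma> + exp (- ?\<sigma>)"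
      by (simp add: add_pos_pos)
    then show ?thesis
      using sigma(2) delta_mono[OF a that, of \<gamma>] by linarith
  qed
  have "\<exists>v \<in> weighted_space ?\<sigma> w. \<exists>x :: nat \<Rightarrow> real \<Rightarrow> real.
      (\<forall>t. complex_of_real (x 0 t) =
         of_real \<epsilon> * (\<Sum>\<^sub>\<infinity>m. b m * exp (\<i> * of_real (\<gamma> * of_int m * t)))) \<and>
      (\<forall>n\<ge>1. \<forall>t. complex_of_real (x n t) =
         of_real (c * real n) + of_real \<epsilon> * b 0 - v 0 0
           + (\<Sum>\<^sub>\<infinity>m. v n m * exp (\<i> * of_real (of_int m * \<gamma> * t)))) \<and>
      time_periodic x \<and> lattice_solution F x"
    if eps: "\<epsilon> \<in> {- \<eta><..<\<eta>}" for \<epsilon>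
  proof -
    let ?\<beta> = "\<lambda>m. of_real \<epsilon> * b m"
    have "hermitian ?\<beta>"
      using assms(7) by (simp add: hermitian_def)
    moreover have "esum (\<lambda>m. ennreal (w m) * ennreal (cmod (?\<beta> m))) \<le> ennreal \<eta>"
    proof -
      have "esum (\<lambda>m. ennreal (w m) * ennreal (cmod (?\<beta> m)))
          = esum (\<lambda>m. ennreal \<bar>\<epsilon>\<bar> * ennreal (w m * cmod (b m)))"
        using w0 by (simp add: norm_mult ennreal_mult mult_ac)
      also have "\<dots> = ennreal \<bar>\<epsilon>\<bar>"
        by (simp add: nn_integral_cmult b1)
      also have "\<dots> \<le> ennreal \<eta>"
        using eps by (intro ennreal_leI) auto
      finally show ?thesis .
    qed
    ultimately obtain v where v: "nrm v < \<infinity>" and herm: "\<And>n. hermitian (v n)"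
      and fixp: "step ?a \<gamma> h ?\<beta> v = v" and small: "\<And>n. l1norm (strain v n) \<le> ennreal \<rho>"
      using ex by blast
    have l1: "l1norm (v n) < \<infinity>" for n
      by (rule le_less_trans[OF l1norm_le_nrm v])
    define C where "C = Re (of_real \<epsilon> * b 0 - v 0 0)"
    define x where "x n t = c * real n + C + Re (trig (v n) (\<gamma> * t))" for n t
    have C: "of_real \<epsilon> * b 0 - v 0 0 = of_real C"
    proof -
      have "cnj (b 0) = b 0" "cnj (v 0 0) = v 0 0"
        using assms(7) herm[of 0] unfolding hermitian_def by (metis minus_zero)+
      then have "of_real \<epsilon> * b 0 - v 0 0 \<in> \<real>"
        by (simp add: Reals_cnj_iff)
      then show ?thesis
        unfolding C_def by (rule of_real_Re[symmetric])
    qed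
    have x_trig: "complex_of_real (x n t)
        = of_real (c * real n) + (of_real \<epsilon> * b 0 - v 0 0) + trig (v n) (\<gamma> * t)" for n t
      unfolding C using trig_real[OF herm] by (simp add: x_def of_real_Re)
    have "complex_of_real (x 0 t) = of_real \<epsilon> * trig b (\<gamma> * t)" for t
    proof -
      \<comment> \<open>the Fourier series of \<open>v 0\<close> and of the driver differ in the mode \<open>0\<close> only\<close>
      have "v 0 m = ?\<beta> m" if "m \<noteq> 0" for m
        using fun_cong[OF fun_cong[OF fixp, of 0], of m] that by simp
      then have "trig (\<lambda>m. v 0 m - ?\<beta> m) (\<gamma> * t) = (\<Sum>\<^sub>\<infinity>m\<in>{0}. (v 0 m - ?\<beta> m) * cis (of_int m * (\<gamma> * t)))"
        unfolding trig_def by (intro infsum_cong_neutral) auto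
      then have "trig (v 0) (\<gamma> * t) - of_real \<epsilon> * trig b (\<gamma> * t) = v 0 0 - of_real \<epsilon> * b 0"
        using trig_diff[OF l1 l1_scale[OF l1_b, of "of_real \<epsilon>"]] by (simp add: trig_scale)
      then show ?thesis
        unfolding x_trig by (simp add: algebra_simps)
    qed
    moreover have "time_periodic x"
    proof -
      have "trig f (\<gamma> * (t + 2 * pi / \<gamma>)) = trig f (\<gamma> * t)" for f t
      proof -
        have "cis (of_int m * (\<gamma> * (t + 2 * pi / \<gamma>))) = cis (of_int m * (\<gamma> * t))" for m
        proof -
          have "of_int m * (\<gamma> * (t + 2 * pi / \<gamma>)) = of_int m * (\<gamma> * t) + 2 * pi * of_int m"
            using \<gamma> by (simp add: field_simps)
          then show ?thesis
            by (simp add: cis_mult[symmetric])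
        qed
        then show ?thesis
          by (simp add: trig_def)
      qed
      then show ?thesis
        unfolding time_periodic_def x_def using \<gamma> by (intro exI[of _ "2 * pi / \<gamma>"]) simp
    qed
    moreover have "lattice_solution F x"
      unfolding x_def[abs_def]
      by (rule fixed_point_solves_lattice[OF a \<gamma> delta_nz fixp herm l1 rho small summ expansion])
    moreover have "v \<in> weighted_space ?\<sigma> w"
      unfolding weighted_space_def using le_less_trans[OF weighted_norm_le_nrm v] by simp
    moreover have "trig f (\<gamma> * t) = (\<Sum>\<^sub>\<infinity>m. f m * exp (\<i> * of_real (of_int m * \<gamma> * t)))"
      and "trig f (\<gamma> * t) = (\<Sum>\<^sub>\<infinity>m. f m * exp (\<i> * of_real (\<gamma> * of_int m * t)))" for f t
      by (simp_all add: trig_def cis_conv_exp mult_ac)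
    ultimately show ?thesis
      using x_trig by (intro bexI[of _ v] exI[of _ x]) (simp_all add: add_diff_eq)
  qed
  moreover have "0 \<in> interior {- \<eta><..<\<eta>}"
    using \<eta> by (simp add: interior_open)
  ultimately show ?thesis
    using sigma(1) by blast
qed

end
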